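(* Let $X$ be a compact connected Riemann surface of genus $g(X)$. Fix integers $d\ge 5$, $s\ge 0$ and partitions $\mu^{(1)},\dots,\mu^{(s)},\nu\vdash d$ with $\nu\neq(1^d)$. For an integer $g\ge0$ put $$q=q(g)=\frac{1}{l^*(\nu)}\Big(2g+(2-2g(X))d-2-\sum_{i=1}^s l^*(\mu^{(i)})\Big).$$ Then, as $g\to\infty$ through those integers for which $q(g)$ is a positive integer, $$H^X_{g,d}\big(\mu^{(1)},\dots,\mu^{(s)},\underbrace{\nu,\dots,\nu}_{q}\big)\ \sim\ \frac{2\,(d!)^{s+2g(X)-2}}{z_{\mu^{(1)}}\cdots z_{\mu^{(s)}}}\Big(\frac{d!}{z_\nu}\Big)^{q},$$ i.e. the ratio of the two sides tends to $1$.
   Context: For a partition $\theta=(\theta_1\ge\dots\ge\theta_l>0)\vdash d$: $l(\theta)=l$, $l^*(\theta)=d-l(\theta)$, $m_i(\theta)$ is the multiplicity of the part $i$ in $\theta$, and $z_\theta=\prod_i m_i(\theta)!\,i^{m_i(\theta)}$. Empty products (when $s=0$) are $1$. $H^X_{g,d}(\theta^{(1)},\dots,\theta^{(n)})$ is the connected Hurwitz number: the number of isomorphism classes, each weighted by $1/|\mathrm{Aut}|$, of degree-$d$ ramified coverings $f:C\to X$ with $C$ a connected compact Riemann surface of genus $g$, with ramification profiles $\theta^{(1)},\dots,\theta^{(n)}\vdash d$ over $n$ fixed distinct points of $X$ and unramified elsewhere. Equivalently, when the Riemann–Hurwitz relation $2g-2=d(2g(X)-2)+\sum_j l^*(\theta^{(j)})$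 holds, it equals $\frac{1}{d!}$ times the number of tuples $(a_1,b_1,\dots,a_{g(X)},b_{g(X)},\sigma_1,\dots,\sigma_n)$ of elements of the symmetric group $S_d$ with $\sigma_j$ of cycle type $\theta^{(j)}$, $\prod_i[a_i,b_i]\prod_j\sigma_j=1$, generating a transitive subgroup of $S_d$. The number $q$ of copies of $\nu$ is the one forced by Riemann–Hurwitz. *)

theory Defs
  imports
    Complex_Main
    "HOL-Algebra.Sym_Groups"
    "HOL-Combinatorics.Orbits"
    "HOL-Library.Multiset"
    "HOL-Library.Landau_Symbols"
begin

text \<open>A partition of \<open>d\<close> is encoded as the multiset of its (positive) parts.\<close>

definition number_partition :: "nat \<Rightarrow> nat multiset \<Rightarrow> bool"
  where "number_partition d \<theta> \<longleftrightarrow> (\<forall>i\<in>#\<theta>. 0 < i) \<and> sum_mset \<theta> = d"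

definition colength :: "nat multiset \<Rightarrow> int"
  where "colength \<theta> = int (sum_mset \<theta>) - int (size \<theta>)"

definition z_partition :: "nat multiset \<Rightarrow> nat"
  where "z_partition \<theta> = (\<Prod>i\<in>set_mset \<theta>. fact (count \<theta> i) * i ^ count \<theta> i)"

text \<open>Fixed points count as orbits of size 1, so the cycle type of a permutation of \<open>{1..d}\<close>
  is a partition of \<open>d\<close>. The image \<open>orbit \<sigma> ` {1..d}\<close> is a set, so every orbit
  contributes one part.\<close>

definition cycle_type :: "nat \<Rightarrow> (nat \<Rightarrow> nat) \<Rightarrow> nat multiset"
  where "cycle_type d \<sigma> = image_mset card (mset_set (Orbits.orbit \<sigma> ` {1..d}))"

definition group_commutator :: "('a, 'b) monoid_scheme \<Rightarrow> 'a \<Rightarrow> 'a \<Rightarrow> 'a"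
  where "group_commutator G a b = a \<otimes>\<^bsub>G\<^esub> b \<otimes>\<^bsub>G\<^esub> inv\<^bsub>G\<^esub> a \<otimes>\<^bsub>G\<^esub> inv\<^bsub>G\<^esub> b"

definition list_product :: "('a, 'b) monoid_scheme \<Rightarrow> 'a list \<Rightarrow> 'a"
  where "list_product G xs = foldr (\<lambda>x y. x \<otimes>\<^bsub>G\<^esub> y) xs \<one>\<^bsub>G\<^esub>"

text \<open>The monodromy data of connected degree \<open>d\<close> coverings of a compact connected Riemann
  surface of genus \<open>h\<close> with ramification profiles \<open>\<theta>s\<close> over fixed distinct points: the lists
  \<open>as\<close>, \<open>bs\<close>, \<open>\<sigma>s\<close> are the images of the standard generators of the fundamental group of the
  punctured surface, which satisfy the single relation
  \<open>[a\<^sub>1, b\<^sub>1] \<cdots> [a\<^sub>h, b\<^sub>h] \<sigma>\<^sub>1 \<cdots> \<sigma>\<^sub>n = 1\<close>.\<close>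

definition monodromy_tuples ::
    "nat \<Rightarrow> nat \<Rightarrow> nat multiset list
      \<Rightarrow> ((nat \<Rightarrow> nat) list \<times> (nat \<Rightarrow> nat) list \<times> (nat \<Rightarrow> nat) list) set"
  where "monodromy_tuples h d \<theta>s =
    {(as, bs, \<sigma>s).
       length as = h \<and> length bs = h \<and>
       set as \<union> set bs \<union> set \<sigma>s \<subseteq> carrier (sym_group d) \<and>
       map (cycle_type d) \<sigma>s = \<theta>s \<and>
       list_product (sym_group d) (map2 (group_commutator (sym_group d)) as bs @ \<sigma>s)
         = \<one>\<^bsub>sym_group d\<^esub> \<and>
       (\<forall>x\<in>{1..d}. \<forall>y\<in>{1..d}.
          \<exists>p\<in>generate (sym_group d) (set as \<union> set bs \<union> set \<sigma>s). p x = y)}"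

text \<open>The connected Hurwitz number \<open>H\<^sup>X\<^bsub>g,d\<^esub>(\<theta>s)\<close> of a compact connected Riemann surface \<open>X\<close> of
  genus \<open>h\<close>, in its monodromy form; it depends on \<open>X\<close> only through \<open>h\<close>. If the
  Riemann-Hurwitz relation fails, there are no such coverings by curves of genus \<open>g\<close>.\<close>

definition hurwitz_number :: "nat \<Rightarrow> nat \<Rightarrow> nat \<Rightarrow> nat multiset list \<Rightarrow> real"
  where "hurwitz_number h g d \<theta>s =
    (if 2 * int g - 2 = int d * (2 * int h - 2) + (\<Sum>\<theta>\<leftarrow>\<theta>s. colength \<theta>)
     then real (card (monodromy_tuples h d \<theta>s)) / fact d
     else 0)"

end

theory Submission
  imports Defs
begin

text \<open>
  Write \<open>C\<close> for the conjugacy class of permutations of cycle type \<open>\<nu>\<close>. A tuple counted by the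
  Hurwitz number is a base part \<open>t\<close>, made of the \<open>as\<close>, the \<open>bs\<close> and the permutations of cycle
  types \<open>\<mu>\<close>, followed by a word of length \<open>q\<close> in \<open>C\<close> whose product is the inverse of the product
  \<open>w\<^sub>t\<close> of the base part. There is a fixed finite number of base parts, so everything rests on
  the number of words of length \<open>q\<close> in \<open>C\<close> with a given product.

  This is a random walk on \<open>S\<^sub>d\<close> with steps in \<open>C\<close>. The products of words of even length form a
  subgroup that is normal in \<open>S\<^sub>d\<close> and is not trivial, because \<open>\<nu> \<noteq> (1\<^sup>d)\<close>; as \<open>d \<ge> 5\<close>, it
  contains a 3-cycle and hence all of \<open>A\<^sub>d\<close> (\<open>alternating_subset_normal\<close>). Since \<open>C\<close> is closed
  under inverses, the walk of even steps can also stand still, so some fixed number of even steps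
  reaches every point of \<open>A\<^sub>d\<close>. A walk on a finite group with this property approaches the uniform
  distribution (\<open>convolution_semigroup_equidistributes\<close>). So the words of length \<open>q\<close> with product
  \<open>x\<close> number about \<open>|C|\<^sup>q \<cdot> 2/d!\<close>, provided that \<open>x\<close> has the sign of a product of \<open>q\<close> elements
  of \<open>C\<close>. For \<open>x = w\<^sub>t\<^sup>-\<^sup>1\<close> this is a parity condition, and the Riemann-Hurwitz relation says that
  \<open>\<Sum>\<^sub>i l\<^sup>*(\<mu>\<^sub>i) + q l\<^sup>*(\<nu>)\<close> is even, which is exactly that condition
  because the sign of a permutation is \<open>(-1)\<close> to the colength of its cycle type.

  Transitivity costs nothing in the limit: a tuple that does not act transitively preserves a proper
  nonempty subset \<open>X\<close> of \<open>{1..d}\<close>, some element of \<open>C\<close> does not, and so the number of these tuples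
  is \<open>O(b\<^sup>q)\<close> with \<open>b < |C|\<close> (\<open>not_transitive_negligible\<close>).

  The Hurwitz number is thus asymptotic to \<open>1/d! \<cdot> 2/d! \<cdot> |C|\<^sup>q\<close> times the number of base
  parts, and the class size \<open>d!/z\<^sub>\<theta>\<close> (\<open>card_cycle_class\<close>) turns this into the stated formula.
\<close>

section \<open>Cycle types and class sizes\<close>

text \<open>
  A permutation of \<open>{1..d+1}\<close> is \<open>(d+1 b) \<circ> p\<close> for a unique \<open>b\<close> and a unique permutation \<open>p\<close> of
  \<open>{1..d}\<close>. For \<open>b = d + 1\<close> the new point is fixed; otherwise it is spliced into the orbit of \<open>b\<close>
  just before \<open>b\<close>, so one part \<open>i\<close> of the cycle type becomes \<open>i + 1\<close>. Signs and class sizes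
  follow by induction on \<open>d\<close>.
\<close>

lemma orbit_transpose_comp_self:
  assumes "finite S" "p permutes S" "x \<notin> S" "b \<in> S"
  shows "orbit (transpose x b \<circ> p) x = insert x (orbit p b)"
proof -
  let ?p' = "transpose x b \<circ> p"
  have px: "p x = x" using assms by (simp add: permutes_not_in)
  have b_neq: "x \<noteq> b" using assms by auto
  have perm: "permutation p" "permutation ?p'"
    using assms 
    by (auto intro!: permutation_compose permutation_swap_id intro: permutes_imp_permutation)
  have p_neq: "p y \<noteq> x" if "y \<in> orbit p b" for y
    using permutes_orbit_subset[OF assms(2,4)] that assms(2,3) orbit.step[OF that] by auto
  have b_in: "b \<in> orbit ?p' x"
    using orbit.base[of ?p' x] px by simp
  have x_in: "x \<in> orbit ?p' x" by (rule permutation_self_in_orbit[OF perm(2)])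
  have "y \<in> orbit ?p' x" if "y \<in> orbit p b" for y
    using that
  proof induction
    case base
    have "p b \<noteq> x" using p_neq permutation_self_in_orbit[OF perm(1)] by blast
    then have "p b = b \<or> ?p' b = p b" by (auto simp: transpose_def)
    then show ?case using orbit.step[OF b_in] b_in by metis
  next
    case (step y)
    then have "p y = b \<or> ?p' y = p y"
      using p_neq[OF step.hyps] by (auto simp: transpose_def)
    then show ?case using orbit.step[OF step.IH] b_in by metis
  qed
  moreover have "y \<in> insert x (orbit p b)" if "y \<in> orbit ?p' x" for y
    using that
  proof induction
    case base
    then show ?case using px permutation_self_in_orbit[OF perm(1)] by simp
  next
    case (step y)
    then show ?case
      using px permutation_self_in_orbit[OF perm(1)] by (auto simp: transpose_def intro: orbit.step)
  qed
  ultimately show ?thesis using x_in by blast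
qed

lemma orbit_transpose_comp_other:
  assumes "finite S" "p permutes S" "x \<notin> S" "y \<in> S" "b \<notin> orbit p y"
  shows "orbit (transpose x b \<circ> p) y = orbit p y"
proof (rule orbit_cong)
  show "y \<in> orbit p y"
    using assms(1,2) by (blast intro: permutation_self_in_orbit permutes_imp_permutation)
next
  fix s assume s: "s \<in> orbit p y"
  have "p s \<noteq> x" using permutes_orbit_subset[OF assms(2,4)] orbit.step[OF s] assms(3) by auto
  moreover have "p s \<noteq> b" using orbit.step[OF s] assms(5) by auto
  ultimately show "(transpose x b \<circ> p) s = p s" by simp
qed

lemma orbit_eq_of_mem:
  assumes "permutation p" "y \<in> orbit p x"
  shows "orbit p y = orbit p x"
  using orbit_cyclic_eq3[OF cyclic_on_orbit'[OF assms(1)] assms(2)] .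

lemma cycle_type_Suc_fixed:
  assumes "p permutes {1..d}"
  shows "cycle_type (Suc d) p = add_mset 1 (cycle_type d p)"
proof -
  have "orbit p (Suc d) = {Suc d}"
    using assms by (simp add: orbit_eq_singleton_iff permutes_not_in)
  moreover have "{1..Suc d} = insert (Suc d) {1..d}" by auto
  ultimately have *: "orbit p ` {1..Suc d} = insert {Suc d} (orbit p ` {1..d})" by simp
  have "{Suc d} \<notin> orbit p ` {1..d}"
  proof
    assume "{Suc d} \<in> orbit p ` {1..d}"
    then obtain y where "y \<in> {1..d}" "orbit p y = {Suc d}" by auto
    then show False using permutes_orbit_subset[OF assms, of y] by auto
  qed
  then show ?thesis unfolding cycle_type_def * by simp
qed

lemma card_orbit_in_cycle_type:
  assumes "b \<in> {1..d}"
  shows "card (orbit p b) \<in># cycle_type d p"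
  using assms unfolding cycle_type_def by auto

text \<open>Truncated subtraction of multisets is harmless in this formula: the part that is removed
  occurs, by \<open>card_orbit_in_cycle_type\<close>.\<close>

lemma cycle_type_Suc_swap:
  assumes "p permutes {1..d}" "b \<in> {1..d}"
  shows "cycle_type (Suc d) (transpose (Suc d) b \<circ> p)
    = add_mset (Suc (card (orbit p b))) (cycle_type d p - {#card (orbit p b)#})"
proof -
  let ?S = "{1..d}" and ?x = "Suc d"
  let ?p' = "transpose ?x b \<circ> p"
  let ?O = "orbit p b"
  have x: "?x \<notin> ?S" by simp
  have perm: "permutation p" "permutation ?p'"
    using assms finite_atLeastAtMost[of 1 d]
    by (auto intro!: permutation_compose permutation_swap_id intro: permutes_imp_permutation)
  have O_sub: "?O \<subseteq> ?S" by (rule permutes_orbit_subset[OF assms])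
  have self: "orbit ?p' ?x = insert ?x ?O"
    by (rule orbit_transpose_comp_self[OF _ assms(1) x assms(2)]) simp
  have inO: "orbit ?p' y = insert ?x ?O" if "y \<in> ?O" for y
    using orbit_eq_of_mem[OF perm(2), of y ?x] self that by simp
  have notinO: "orbit ?p' y = orbit p y" if "y \<in> ?S" "y \<notin> ?O" for y
  proof (rule orbit_transpose_comp_other[OF _ assms(1) x that(1)])
    show "b \<notin> orbit p y"
      using orbit_eq_of_mem[OF perm(1), of b y] permutation_self_in_orbit[OF perm(1), of y] that(2) by auto
  qed simp
  have "orbit ?p' ` ?S \<union> {insert ?x ?O} = insert (insert ?x ?O) (orbit p ` ?S - {?O})" (is "?L = ?R")
  proof
    show "?L \<subseteq> ?R"
    proof
      fix X assume "X \<in> ?L"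
      then consider "X = insert ?x ?O" | y where "y \<in> ?S" "X = orbit ?p' y" by auto
      then show "X \<in> ?R"
      proof cases
        case 2
        show ?thesis
        proof (cases "y \<in> ?O")
          case True then show ?thesis using 2 inO by simp
        next
          case False
          then show ?thesis using 2 notinO[of y] permutation_self_in_orbit[OF perm(1), of y] by auto
        qed
      qed simp
    qed
    show "?R \<subseteq> ?L"
    proof
      fix X assume "X \<in> ?R"
      then consider "X = insert ?x ?O" | y where "y \<in> ?S" "X = orbit p y" "X \<noteq> ?O" by blast
      then show "X \<in> ?L"
      proof cases
        case 2
        then have "y \<notin> ?O" using orbit_eq_of_mem[OF perm(1), of y b] by auto
        then show ?thesis using 2 notinO[of y] by auto
      qed simp
    qed
  qed
  moreover have "{1..Suc d} = insert ?x ?S" by auto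
  ultimately have orbs: "orbit ?p' ` {1..Suc d} = insert (insert ?x ?O) (orbit p ` ?S - {?O})"
    using self by auto
  have new: "insert ?x ?O \<notin> orbit p ` ?S - {?O}"
  proof
    assume "insert ?x ?O \<in> orbit p ` ?S - {?O}"
    then obtain y where "y \<in> ?S" "orbit p y = insert ?x ?O"
      by (metis (no_types, lifting) DiffD1 imageE)
    then show False using permutes_orbit_subset[OF assms(1), of y] by auto
  qed
  have card_new: "card (insert ?x ?O) = Suc (card ?O)"
    using O_sub x by (subst card_insert_disjoint) (auto intro: finite_subset)
  have "mset_set (orbit p ` ?S - {?O}) = mset_set (orbit p ` ?S) - {#?O#}"
    using assms(2) by (subst mset_set_Diff) auto
  moreover have "image_mset card (mset_set (orbit p ` ?S) - {#?O#}) = cycle_type d p - {#card ?O#}"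
    unfolding cycle_type_def using assms(2) by (subst image_mset_Diff) auto
  ultimately show ?thesis
    unfolding cycle_type_def[of "Suc d"] orbs using new card_new by simp
qed

lemma permutes_Suc_cases:
  assumes "p permutes {1..Suc d}"
  obtains (fixed) "p permutes {1..d}"
  | (swap) b q where "b \<in> {1..d}" "q permutes {1..d}" "p = transpose (Suc d) b \<circ> q"
proof -
  have ins: "{1..Suc d} = insert (Suc d) {1..d}" by auto
  have "p \<in> {p. p permutes insert (Suc d) {1..d}}" using assms ins by simp
  then obtain b q where bq: "b \<in> insert (Suc d) {1..d}" "q permutes {1..d}" "p = transpose (Suc d) b \<circ> q"
    unfolding permutes_insert by auto
  show thesis
  proof (cases "b = Suc d")
    case True
    then show thesis using bq fixed by simp
  next
    case False
    then show thesis using bq swap by auto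
  qed
qed

lemma card_orbit_pos:
  fixes d :: nat
  assumes "p permutes {1..d}" "b \<in> {1..d}"
  shows "0 < card (orbit p b)"
proof -
  have "finite (orbit p b)" by (rule finite_subset[OF permutes_orbit_subset[OF assms]]) simp
  then show ?thesis using orbit_nonempty[of p b] by (simp add: card_gt_0_iff)
qed

text \<open>Splicing the new point into an orbit multiplies the permutation by a transposition and
  raises the colength by one; adding a fixed point changes neither sign nor colength. Nonnegativity
  keeps \<open>nat\<close> from truncating.\<close>

lemma sign_eq_colength:
  assumes "p permutes {1..d}"
  shows "sign p = (-1) ^ nat (colength (cycle_type d p)) \<and> colength (cycle_type d p) \<ge> 0"
  using assms
proof (induction d arbitrary: p)
  case 0
  then show ?case by (simp add: cycle_type_def colength_def)
next
  case (Suc d)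
  from Suc.prems show ?case
  proof (cases rule: permutes_Suc_cases)
    case fixed
    then show ?thesis using Suc.IH[OF fixed] by (simp add: cycle_type_Suc_fixed colength_def)
  next
    case (swap b q)
    let ?c = "card (orbit q b)"
    obtain t where t: "cycle_type d q = add_mset ?c t"
      using card_orbit_in_cycle_type[OF swap(1)] by (metis insert_DiffM)
    then have "cycle_type (Suc d) p = add_mset (Suc ?c) t"
      using swap by (simp add: cycle_type_Suc_swap)
    then have col: "colength (cycle_type (Suc d) p) = colength (cycle_type d q) + 1"
      using t by (simp add: colength_def)
    have "permutation q" using swap(2) by (auto simp: permutation_permutes)
    then have "sign p = - sign q"
      unfolding swap(3) using swap(1) by (subst sign_compose) (auto simp: permutation_swap_id sign_swap_id)
    then show ?thesis using col Suc.IH[OF swap(2)] by (simp add: nat_add_distrib)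
  qed
qed

text \<open>The number of places where a new point can be spliced into an orbit of size \<open>i\<close>.\<close>

lemma card_points_in_orbits_of_size:
  assumes "p permutes {1..d}"
  shows "card {b \<in> {1..d}. card (orbit p b) = i} = i * count (cycle_type d p) i"
proof -
  let ?U = "{X \<in> orbit p ` {1..d}. card X = i}"
  have perm: "permutation p" using assms by (auto simp: permutation_permutes)
  have "{b \<in> {1..d}. card (orbit p b) = i} = \<Union> ?U"
  proof
    show "{b \<in> {1..d}. card (orbit p b) = i} \<subseteq> \<Union> ?U"
      using permutation_self_in_orbit[OF perm] by blast
    show "\<Union> ?U \<subseteq> {b \<in> {1..d}. card (orbit p b) = i}"
      using permutes_orbit_subset[OF assms] orbit_eq_of_mem[OF perm] by fastforce
  qed
  moreover have "card (\<Union> ?U) = (\<Sum>X\<in>?U. card X)"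
  proof (rule card_Union_disjoint)
    show "pairwise disjnt ?U"
      unfolding pairwise_def disjnt_def using orbit_eq_of_mem[OF perm] by blast
    show "\<And>A. A \<in> ?U \<Longrightarrow> finite A"
      using finite_subset[OF permutes_orbit_subset[OF assms]] by auto
  qed
  moreover have "count (cycle_type d p) i = card ?U"
    unfolding cycle_type_def by (rule count_image_mset_eq_card_vimage) simp
  ultimately show ?thesis by (simp add: mult.commute)
qed

lemma z_partition_superset:
  assumes "finite A" "set_mset \<theta> \<subseteq> A"
  shows "z_partition \<theta> = (\<Prod>i\<in>A. fact (count \<theta> i) * i ^ count \<theta> i)"
  unfolding z_partition_def
  by (rule prod.mono_neutral_left) (use assms in \<open>auto simp: not_in_iff\<close>)

lemma z_partition_add_mset:
  "z_partition (add_mset i \<theta>) = Suc (count \<theta> i) * i * z_partition \<theta>"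
proof -
  let ?A = "insert i (set_mset \<theta>)"
  let ?f = "\<lambda>\<theta> i. fact (count \<theta> i) * i ^ count \<theta> i :: nat"
  have "z_partition (add_mset i \<theta>) = ?f (add_mset i \<theta>) i * prod (?f (add_mset i \<theta>)) (?A - {i})"
    by (subst z_partition_superset[of ?A]) (auto simp: prod.remove[of ?A i])
  also have "prod (?f (add_mset i \<theta>)) (?A - {i}) = prod (?f \<theta>) (?A - {i})"
    by (rule prod.cong) auto
  also have "?f (add_mset i \<theta>) i = Suc (count \<theta> i) * i * ?f \<theta> i"
    by (simp add: algebra_simps)
  also have "\<dots> * prod (?f \<theta>) (?A - {i}) = Suc (count \<theta> i) * i * (?f \<theta> i * prod (?f \<theta>) (?A - {i}))"
    by (simp only: mult.assoc)
  also have "?f \<theta> i * prod (?f \<theta>) (?A - {i}) = z_partition \<theta>"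
    by (subst z_partition_superset[of ?A]) (auto simp: prod.remove[of ?A i])
  finally show ?thesis .
qed

lemma z_partition_pos:
  assumes "number_partition d \<theta>"
  shows "0 < z_partition \<theta>"
  using assms unfolding z_partition_def number_partition_def by (intro prod_pos) auto

definition cycle_class :: "nat \<Rightarrow> nat multiset \<Rightarrow> (nat \<Rightarrow> nat) set"
  where "cycle_class d \<theta> = {p. p permutes {1..d} \<and> cycle_type d p = \<theta>}"

lemma finite_cycle_class: "finite (cycle_class d \<theta>)"
  by (rule finite_subset[OF _ finite_permutations[of "{1..d}"]]) (auto simp: cycle_class_def)

lemma sum_over_orbit_sizes:
  fixes g :: "nat \<Rightarrow> real"
  assumes "p permutes {1..d}"
  shows "(\<Sum>b\<in>{1..d}. g (card (orbit p b))) = (\<Sum>i\<in>{1..d}. real (i * count (cycle_type d p) i) * g i)"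
proof -
  have "card (orbit p b) \<in> {1..d}" if "b \<in> {1..d}" for b
    using card_orbit_pos[OF assms that] card_mono[OF _ permutes_orbit_subset[OF assms that]] by simp
  then have "(\<Sum>b\<in>{1..d}. g (card (orbit p b)))
      = (\<Sum>i\<in>{1..d}. \<Sum>b | b \<in> {1..d} \<and> card (orbit p b) = i. g (card (orbit p b)))"
    by (intro sum.group[symmetric]) auto
  also have "\<dots> = (\<Sum>i\<in>{1..d}. real (card {b \<in> {1..d}. card (orbit p b) = i}) * g i)"
    by (intro sum.cong) auto
  finally show ?thesis by (simp only: card_points_in_orbits_of_size[OF assms])
qed

lemma card_cycle_class_eq_sum:
  "real (card (cycle_class d \<theta>)) = (\<Sum>p | p permutes {1..d}. of_bool (cycle_type d p = \<theta>))"
proof -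
  have "cycle_class d \<theta> = {p. p permutes {1..d}} \<inter> {p. cycle_type d p = \<theta>}"
    by (auto simp: cycle_class_def)
  then show ?thesis by (simp add: finite_permutations sum_of_bool_eq)
qed

lemma add_mset_eq_iff_diff: "add_mset a A = B \<longleftrightarrow> a \<in># B \<and> A = B - {#a#}"
  by auto

text \<open>Recursion for class sizes: a permutation of type \<open>\<theta>\<close> on \<open>{1..d+1}\<close> arises either from one
  of type \<open>\<theta> - {1}\<close> by adding a fixed point, or, for a part \<open>i + 1\<close> of \<open>\<theta>\<close>, from one in which
  this part is \<open>i\<close>, by splicing the new point into one of the orbits of size \<open>i\<close>. Such a permutation
  has \<open>count \<theta> i + 1\<close> orbits of size \<open>i\<close>, hence \<open>i (count \<theta> i + 1)\<close> places to splice.\<close>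

lemma card_cycle_class_Suc:
  "real (card (cycle_class (Suc d) \<theta>))
    = of_bool (1 \<in># \<theta>) * real (card (cycle_class d (\<theta> - {#1#})))
    + (\<Sum>i\<in>{1..d}. of_bool (Suc i \<in># \<theta>) * real (i * Suc (count \<theta> i))
         * real (card (cycle_class d (add_mset i (\<theta> - {#Suc i#})))))"
proof -
  let ?P = "{p. p permutes {1..d}}"
  have ins: "{1..Suc d} = insert (Suc d) {1..d}" by auto
  have "real (card (cycle_class (Suc d) \<theta>))
      = (\<Sum>b\<in>insert (Suc d) {1..d}. \<Sum>q\<in>?P. of_bool (cycle_type (Suc d) (transpose (Suc d) b \<circ> q) = \<theta>))"
    unfolding card_cycle_class_eq_sum ins by (rule sum_over_permutations_insert) auto
  also have "\<dots> = (\<Sum>q\<in>?P. of_bool (cycle_type (Suc d) q = \<theta>))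
      + (\<Sum>b\<in>{1..d}. \<Sum>q\<in>?P. of_bool (cycle_type (Suc d) (transpose (Suc d) b \<circ> q) = \<theta>))"
    by simp
  also have "(\<Sum>q\<in>?P. of_bool (cycle_type (Suc d) q = \<theta>))
      = (\<Sum>q\<in>?P. of_bool (1 \<in># \<theta>) * of_bool (cycle_type d q = \<theta> - {#1#}) :: real)"
    by (rule sum.cong) (simp_all add: cycle_type_Suc_fixed add_mset_eq_iff_diff)
  also have "\<dots> = of_bool (1 \<in># \<theta>) * real (card (cycle_class d (\<theta> - {#1#})))"
    by (simp only: card_cycle_class_eq_sum sum_distrib_left)
  also have "(\<Sum>b\<in>{1..d}. \<Sum>q\<in>?P. of_bool (cycle_type (Suc d) (transpose (Suc d) b \<circ> q) = \<theta>))
      = (\<Sum>q\<in>?P. \<Sum>b\<in>{1..d}. of_bool (add_mset (Suc (card (orbit q b))) (cycle_type d q - {#card (orbit q b)#}) = \<theta>) :: real)"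
    by (subst sum.swap) (intro sum.cong refl, simp add: cycle_type_Suc_swap)
  also have "\<dots> = (\<Sum>q\<in>?P. \<Sum>i\<in>{1..d}. real (i * count (cycle_type d q) i) *
        of_bool (add_mset (Suc i) (cycle_type d q - {#i#}) = \<theta>))"
    by (intro sum.cong refl sum_over_orbit_sizes) simp
  also have "\<dots> = (\<Sum>i\<in>{1..d}. \<Sum>q\<in>?P. real (i * count (cycle_type d q) i) *
        of_bool (add_mset (Suc i) (cycle_type d q - {#i#}) = \<theta>))"
    by (rule sum.swap)
  also have "\<dots> = (\<Sum>i\<in>{1..d}. \<Sum>q\<in>?P. of_bool (Suc i \<in># \<theta>) * real (i * Suc (count \<theta> i))
         * of_bool (cycle_type d q = add_mset i (\<theta> - {#Suc i#})))"
  proof (intro sum.cong refl)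
    fix i q
    let ?t = "cycle_type d q"
    show "real (i * count ?t i) * of_bool (add_mset (Suc i) (?t - {#i#}) = \<theta>) =
       of_bool (Suc i \<in># \<theta>) * real (i * Suc (count \<theta> i)) * of_bool (?t = add_mset i (\<theta> - {#Suc i#}))"
    proof (cases "i \<in># ?t")
      case True
      then obtain t where "?t = add_mset i t" by (metis insert_DiffM)
      then show ?thesis by auto
    next
      case False
      then show ?thesis by (auto simp: not_in_iff)
    qed
  qed
  also have "\<dots> = (\<Sum>i\<in>{1..d}. of_bool (Suc i \<in># \<theta>) * real (i * Suc (count \<theta> i))
         * real (card (cycle_class d (add_mset i (\<theta> - {#Suc i#})))))"
    by (simp only: card_cycle_class_eq_sum sum_distrib_left)
  finally show ?thesis .
qed

lemma sum_mset_eq_sum_count: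
  fixes \<theta> :: "nat multiset"
  assumes "finite A" "set_mset \<theta> \<subseteq> A"
  shows "sum_mset \<theta> = (\<Sum>i\<in>A. i * count \<theta> i)"
  using assms(2)
proof (induction \<theta>)
  case (add x \<theta>)
  have "(\<Sum>i\<in>A. i * count (add_mset x \<theta>) i) = (\<Sum>i\<in>A. i * count \<theta> i + (if i = x then i else 0))"
    by (rule sum.cong) auto
  also have "\<dots> = (\<Sum>i\<in>A. i * count \<theta> i) + x"
    using add.prems assms(1) by (simp add: sum.distrib)
  finally show ?case using add by simp
qed simp

text \<open>With the induction hypothesis, the part \<open>j\<close> of \<open>\<theta>\<close> contributes
  \<open>d!/z\<^sub>\<theta> \<cdot> j \<cdot> count \<theta> j\<close> to the recursion, both for \<open>j = 1\<close> and for \<open>j = i + 1\<close>. The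
  contributions add up to \<open>(d+1)!/z\<^sub>\<theta>\<close>, since the parts of \<open>\<theta>\<close> add up to \<open>d + 1\<close>.\<close>

theorem card_cycle_class:
  assumes "number_partition d \<theta>"
  shows "real (card (cycle_class d \<theta>)) = fact d / real (z_partition \<theta>)"
  using assms
proof (induction d arbitrary: \<theta>)
  case 0
  then have "\<theta> = {#}"
    by (metis bot_nat_0.not_eq_extremum multiset_nonemptyE number_partition_def sum_mset_0_iff)
  then show ?case by (simp add: cycle_class_def cycle_type_def z_partition_def)
next
  case (Suc d)
  have pos: "z_partition \<theta> > 0" by (rule z_partition_pos[OF Suc.prems])
  have 1: "of_bool (1 \<in># \<theta>) * real (card (cycle_class d (\<theta> - {#1#})))
      = fact d / real (z_partition \<theta>) * real (1 * count \<theta> 1)"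
  proof (cases "1 \<in># \<theta>")
    case True
    then obtain \<rho> where \<rho>: "\<theta> = add_mset 1 \<rho>" by (metis insert_DiffM)
    then have "number_partition d \<rho>" using Suc.prems by (auto simp: number_partition_def)
    note IH = Suc.IH[OF this]
    let ?m = "real (Suc (count \<rho> 1))"
    have "real (z_partition \<theta>) = ?m * real (z_partition \<rho>)"
      unfolding \<rho> z_partition_add_mset by (simp add: distrib_right)
    moreover have "?m \<noteq> 0" by simp
    moreover have "real (1 * count \<theta> 1) = ?m" by (simp add: \<rho>)
    moreover have "\<theta> - {#1#} = \<rho>" by (simp add: \<rho>)
    ultimately show ?thesis
      using True IH by simp
  qed (simp add: not_in_iff)
  have 2: "of_bool (Suc i \<in># \<theta>) * real (i * Suc (count \<theta> i))
         * real (card (cycle_class d (add_mset i (\<theta> - {#Suc i#}))))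
      = fact d / real (z_partition \<theta>) * real (Suc i * count \<theta> (Suc i))" if "i \<in> {1..d}" for i
  proof (cases "Suc i \<in># \<theta>")
    case True
    then obtain \<rho> where \<rho>: "\<theta> = add_mset (Suc i) \<rho>" by (metis insert_DiffM)
    then have np: "number_partition d (add_mset i \<rho>)"
      using Suc.prems that by (auto simp: number_partition_def)
    let ?m = "real (i * Suc (count \<theta> i))" and ?M = "real (Suc i * count \<theta> (Suc i))"
    have "real (card (cycle_class d (add_mset i \<rho>))) = fact d / (?m * real (z_partition \<rho>))"
      unfolding Suc.IH[OF np] z_partition_add_mset by (simp add: \<rho> algebra_simps)
    moreover have "real (z_partition \<theta>) = ?M * real (z_partition \<rho>)"
      unfolding \<rho> z_partition_add_mset by (simp add: algebra_simps)
    moreover have "\<theta> - {#Suc i#} = \<rho>" by (simp add: \<rho>)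
    moreover have "?m \<noteq> 0" "?M \<noteq> 0" using that True unfolding of_nat_eq_0_iff by auto
    ultimately show ?thesis using True by simp
  qed (simp add: not_in_iff)
  have sub: "set_mset \<theta> \<subseteq> {1..Suc d}"
  proof
    fix i assume i: "i \<in># \<theta>"
    then obtain \<rho> where "\<theta> = add_mset i \<rho>" by (metis insert_DiffM)
    then show "i \<in> {1..Suc d}" using Suc.prems by (auto simp: number_partition_def)
  qed
  have "Suc d = (\<Sum>i\<in>{1..Suc d}. i * count \<theta> i)"
    using Suc.prems sum_mset_eq_sum_count[OF _ sub] by (simp only: number_partition_def finite_atLeastAtMost)
  also have "\<dots> = 1 * count \<theta> 1 + (\<Sum>i\<in>{1..d}. Suc i * count \<theta> (Suc i))"
    by (simp only: sum.atLeast_Suc_atMost[of 1 "Suc d"] sum.shift_bounds_cl_Suc_ivl le_add1 One_nat_def Suc_le_mono le0 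
        sum.atLeast_Suc_atMost)
  finally have "real (Suc d) = real (1 * count \<theta> 1 + (\<Sum>i\<in>{1..d}. Suc i * count \<theta> (Suc i)))"
    by (rule arg_cong)
  then have tot: "real (Suc d) = real (1 * count \<theta> 1) + (\<Sum>i\<in>{1..d}. real (Suc i * count \<theta> (Suc i)))"
    by simp
  have "real (card (cycle_class (Suc d) \<theta>)) = fact d / real (z_partition \<theta>) * real (Suc d)"
    unfolding card_cycle_class_Suc 1 tot distrib_left sum_distrib_left using 2 by simp
  then show ?case by simp
qed

section \<open>Normal subgroups of the symmetric group\<close>

lemma exists_permutation_mapping_list:
  assumes "distinct xs" "distinct ys" "length xs = length ys" "set xs \<subseteq> S" "set ys \<subseteq> S"
  shows "\<exists>t. t permutes S \<and> map t xs = ys"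
  using assms
proof (induction xs arbitrary: ys)
  case Nil
  then show ?case by (intro exI[of _ id] conjI permutes_id) simp_all
next
  case (Cons x xs)
  then obtain y ys' where ys: "ys = y # ys'" by (cases ys) auto
  then obtain t where t: "t permutes S" "map t xs = ys'" using Cons by auto
  let ?t = "transpose (t x) y \<circ> t"
  have tx: "t x \<in> S" using t(1) Cons.prems by (simp add: permutes_in_image)
  have "?t permutes S"
    using t(1) tx Cons.prems ys by (intro permutes_compose permutes_swap_id) auto
  moreover have "?t z = t z" if "z \<in> set xs" for z
  proof -
    have "t z \<noteq> t x" using Cons.prems(1) that permutes_inj[OF t(1)] by (auto dest: injD)
    moreover have "t z \<noteq> y" using Cons.prems(2) that t(2) ys by auto
    ultimately show ?thesis by simp
  qed
  then have "map ?t xs = map t xs" by simp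
  then have "map ?t (x # xs) = ys" using t(2) ys by simp
  ultimately show ?case by blast
qed

lemma conjugation_of_transpose:
  assumes "bij t"
  shows "t \<circ> transpose a b \<circ> inv' t = transpose (t a) (t b)"
proof (cases "a = b")
  case True
  then show ?thesis using assms by (simp add: bij_is_surj flip: surj_iff)
next
  case False
  then show ?thesis using conjugation_of_cycle[of "[a, b]" t] assms by simp
qed

definition conj_closed :: "nat \<Rightarrow> (nat \<Rightarrow> nat) set \<Rightarrow> bool"
  where "conj_closed d C \<longleftrightarrow> (\<forall>t p. t permutes {1..d} \<longrightarrow> p \<in> C \<longrightarrow> t \<circ> p \<circ> inv' t \<in> C)"

text \<open>The element is the commutator of \<open>\<sigma>\<close> and the transposition \<open>(a b)\<close>.\<close>

lemma normal_transpose_pair: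
  assumes N: "subgroup N (sym_group d)" "conj_closed d N"
    and "\<sigma> \<in> N" "a \<in> {1..d}" "b \<in> {1..d}"
  shows "transpose (\<sigma> a) (\<sigma> b) \<circ> transpose a b \<in> N"
proof -
  let ?t = "transpose a b"
  have \<sigma>: "\<sigma> \<in> carrier (sym_group d)" using subgroup.subset[OF N(1)] assms(3) by auto
  then have \<sigma>_bij: "bij \<sigma>" by (auto simp: sym_group_carrier permutes_bij)
  have "inv' \<sigma> \<in> N" using subgroup.m_inv_closed[OF N(1) assms(3)] \<sigma> by simp
  moreover have "?t permutes {1..d}" using assms(4,5) by (simp add: permutes_swap_id)
  ultimately have "?t \<circ> inv' \<sigma> \<circ> inv' ?t \<in> N" using N(2) by (auto simp: conj_closed_def)
  then have "\<sigma> \<circ> (?t \<circ> inv' \<sigma> \<circ> inv' ?t) \<in> N"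
    using subgroup.m_closed[OF N(1) assms(3)] by (simp add: sym_group_mult)
  moreover have "\<sigma> \<circ> (?t \<circ> inv' \<sigma> \<circ> inv' ?t) = (\<sigma> \<circ> ?t \<circ> inv' \<sigma>) \<circ> inv' ?t" by (simp add: comp_assoc)
  moreover have "inv' ?t = ?t" by (simp add: inv_unique_comp)
  ultimately show ?thesis using conjugation_of_transpose[OF \<sigma>_bij, of a b] by simp
qed

text \<open>The commutators \<open>(\<sigma> a  \<sigma> b)(a b)\<close> lie in \<open>N\<close>. Such a product is a 3-cycle as soon as the two
  transpositions share exactly one point, which can be arranged unless \<open>\<sigma>\<close> is an involution without
  fixed points. In that case a commutator is a product of two disjoint transpositions, and this
  element has a fixed point because \<open>d \<ge> 5\<close>.\<close>

lemma normal_contains_three_cycle: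
  assumes "d \<ge> 5"
    and N: "subgroup N (sym_group d)" "conj_closed d N"
    and \<sigma>: "\<sigma> \<in> N" "\<sigma> \<noteq> id"
  shows "\<exists>cs. distinct cs \<and> length cs = 3 \<and> set cs \<subseteq> {1..d} \<and> cycle_of_list cs \<in> N"
proof -
  have perm: "\<tau> permutes {1..d}" if "\<tau> \<in> N" for \<tau>
    using subgroup.subset[OF N(1)] that by (auto simp: sym_group_carrier)
  have S: "\<tau> y \<in> {1..d}" if "\<tau> \<in> N" "y \<in> {1..d}" for \<tau> y
    using perm[OF that(1)] that(2) by (simp only: permutes_in_image)
  have inj: "\<tau> y = \<tau> z \<longleftrightarrow> y = z" if "\<tau> \<in> N" for \<tau> y z
    using permutes_inj[OF perm[OF that]] by (auto dest: injD)
  have avoid: "\<exists>z\<in>{1..d}. z \<notin> set xs" if "length xs < 5" for xs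
  proof (rule ccontr)
    assume "\<not> ?thesis"
    then have "card {1..d} \<le> card (set xs)" by (intro card_mono) auto
    then show False using card_length[of xs] that assms(1) by simp
  qed
  \<comment> \<open>For a moved \<open>y\<close> and a fixed \<open>z\<close>, the two transpositions share exactly the point \<open>z\<close>.\<close>
  have fixed: ?thesis
    if "\<tau> \<in> N" "y \<in> {1..d}" "z \<in> {1..d}" "\<tau> y \<noteq> y" "\<tau> z = z" for \<tau> y z
  proof (intro exI conjI)
    have "z \<noteq> y" "\<tau> y \<noteq> z" using that inj[of \<tau> y z] by auto
    then show "distinct [\<tau> y, z, y]" using that by auto
    show "length [\<tau> y, z, y] = 3" by simp
    show "set [\<tau> y, z, y] \<subseteq> {1..d}" using that S by auto
    show "cycle_of_list [\<tau> y, z, y] \<in> N"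
      using normal_transpose_pair[OF N that(1-3)] that(5) by (simp add: transpose_commute)
  qed
  obtain a where a: "\<sigma> a \<noteq> a" using \<sigma>(2) by (auto simp: fun_eq_iff)
  then have aS: "a \<in> {1..d}" using perm[OF \<sigma>(1)] by (auto simp: permutes_def)
  define b where "b = \<sigma> a"
  have b: "b \<noteq> a" "b \<in> {1..d}" using a aS S[OF \<sigma>(1)] by (auto simp: b_def)
  show ?thesis
  proof (cases "\<sigma> b = a")
    case False
    have "distinct [\<sigma> b, b, a]" using False b inj[OF \<sigma>(1), of b a] by (auto simp: b_def)
    moreover have "set [\<sigma> b, b, a] \<subseteq> {1..d}" using aS b S[OF \<sigma>(1)] by auto
    moreover have "cycle_of_list [\<sigma> b, b, a] \<in> N"
      using normal_transpose_pair[OF N \<sigma>(1) aS b(2)]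
      by (simp add: transpose_commute flip: b_def)
    ultimately show ?thesis by (intro exI[of _ "[\<sigma> b, b, a]"]) simp
  next
    case True
    obtain c where c: "c \<in> {1..d}" "c \<noteq> a" "c \<noteq> b" using avoid[of "[a, b]"] by auto
    show ?thesis
    proof (cases "\<sigma> c = c")
      case True
      then show ?thesis using fixed[OF \<sigma>(1) aS c(1) a] by simp
    next
      case c_moved: False
      define e where "e = \<sigma> c"
      have e: "e \<in> {1..d}" "e \<noteq> a" "e \<noteq> b" "e \<noteq> c"
        using S[OF \<sigma>(1) c(1)] c_moved inj[OF \<sigma>(1), of c b] inj[OF \<sigma>(1), of c a] True c
        by (auto simp: e_def b_def)
      obtain f where f: "f \<in> {1..d}" "f \<noteq> a" "f \<noteq> b" "f \<noteq> c" "f \<noteq> e"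
        using avoid[of "[a, b, c, e]"] by auto
      let ?D = "transpose b e \<circ> transpose a c"
      have "?D \<in> N" using normal_transpose_pair[OF N \<sigma>(1) aS c(1)] by (simp add: b_def e_def)
      moreover have "?D b \<noteq> b" "?D f = f" using b c e f by simp_all
      ultimately show ?thesis using fixed b(2) f(1) by blast
    qed
  qed
qed

text \<open>All 3-cycles are conjugate in the symmetric group, and they generate the alternating group.\<close>

lemma alternating_subset_normal:
  assumes "d \<ge> 5"
    and N: "subgroup N (sym_group d)" "conj_closed d N"
    and \<sigma>: "\<sigma> \<in> N" "\<sigma> \<noteq> id"
  shows "carrier (alt_group d) \<subseteq> N"
proof -
  obtain cs where cs: "distinct cs" "length cs = 3" "set cs \<subseteq> {1..d}" "cycle_of_list cs \<in> N"
    using normal_contains_three_cycle[OF assms] by blast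
  have three: "three_cycles d \<subseteq> N"
  proof
    fix p assume "p \<in> three_cycles d"
    then obtain cs' where cs': "p = cycle_of_list cs'" "distinct cs'" "length cs' = 3" "set cs' \<subseteq> {1..d}"
      by auto
    obtain t where t: "t permutes {1..d}" "map t cs = cs'"
      using exists_permutation_mapping_list[of cs cs' "{1..d}"] cs cs' by auto
    then have "t \<circ> cycle_of_list cs \<circ> inv' t = p"
      using conjugation_of_cycle[OF cs(1) permutes_bij[OF t(1)]] cs'(1) by simp
    then show "p \<in> N" using N(2) t(1) cs(4) by (auto simp: conj_closed_def)
  qed
  show ?thesis
  proof
    fix p assume "p \<in> carrier (alt_group d)"
    then have "p \<in> generate (alt_group d) (three_cycles d)"
      using alt_group_carrier_as_three_cycles[of d] by simp
    then show "p \<in> N"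
    proof induction
      case one
      then show ?case using subgroup.one_closed[OF N(1)] by (simp only: alt_group_one sym_group_one)
    next
      case (incl h)
      then show ?case using three by auto
    next
      case (inv h)
      then have "h \<in> N" "h \<in> carrier (alt_group d)" using three three_cycles_incl by auto
      moreover then have "h \<in> carrier (sym_group d)" using subgroup.subset[OF N(1)] by auto
      ultimately show ?case
        using subgroup.m_inv_closed[OF N(1), of h] by (simp add: alt_group_inv_equality)
    next
      case (eng h1 h2)
      then show ?case
        using subgroup.m_closed[OF N(1), of h1 h2] by (simp only: alt_group_mult sym_group_mult)
    qed
  qed
qed

section \<open>Equidistribution of random walks on finite groups\<close>

text \<open>The argument of Doeblin: if \<open>F m \<ge> \<epsilon>\<close> everywhere, then \<open>F m\<close> is \<open>\<epsilon>\<close> times the counting measure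
  plus a nonnegative rest of total mass \<open>c = 1 - \<epsilon> |G| < 1\<close>. Convolution with the counting
  measure annihilates functions of sum 0, such as \<open>F n - 1/|G|\<close>, so every \<open>m\<close> steps shrink the
  distance from the uniform distribution by the factor \<open>c\<close>.\<close>

lemma (in group) convolution_semigroup_equidistributes:
  fixes F :: "nat \<Rightarrow> 'a \<Rightarrow> real"
  assumes fin: "finite (carrier G)"
    and nonneg: "\<And>n x. x \<in> carrier G \<Longrightarrow> 0 \<le> F n x"
    and total: "\<And>n. (\<Sum>x\<in>carrier G. F n x) = 1"
    and conv: "\<And>m n x. x \<in> carrier G \<Longrightarrow> F (m + n) x = (\<Sum>y\<in>carrier G. F m y * F n (inv y \<otimes> x))"
    and m: "0 < m" "\<And>x. x \<in> carrier G \<Longrightarrow> 0 < F m x"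
    and x: "x \<in> carrier G"
  shows "(\<lambda>n. F n x) \<longlonglongrightarrow> 1 / card (carrier G)"
proof -
  define u :: real where "u = 1 / card (carrier G)"
  have card_pos: "0 < card (carrier G)" using fin x by (auto simp: card_gt_0_iff)
  define \<epsilon> where "\<epsilon> = Min (F m ` carrier G)"
  have \<epsilon>_pos: "0 < \<epsilon>" unfolding \<epsilon>_def using fin x m(2) by (subst Min_gr_iff) auto
  have \<epsilon>_le: "\<epsilon> \<le> F m y" if "y \<in> carrier G" for y unfolding \<epsilon>_def using fin that by simp
  define c where "c = 1 - \<epsilon> * card (carrier G)"
  have c_eq: "c = (\<Sum>y\<in>carrier G. F m y - \<epsilon>)"
    by (simp add: c_def sum_subtractf total)
  have "0 \<le> c" unfolding c_eq using \<epsilon>_le by (intro sum_nonneg) auto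
  moreover have "c < 1" using \<epsilon>_pos card_pos by (simp add: c_def)
  ultimately have c: "0 \<le> c" "c < 1" .
  have translate: "(\<Sum>y\<in>carrier G. h (inv y \<otimes> z)) = (\<Sum>y\<in>carrier G. h y)"
    if "z \<in> carrier G" for z and h :: "'a \<Rightarrow> real"
    by (rule sum.reindex_bij_witness[where i="\<lambda>y. z \<otimes> inv y" and j="\<lambda>y. inv y \<otimes> z"])
      (use that in \<open>auto simp: inv_mult_group m_assoc[symmetric]\<close>, simp add: that m_assoc)
  have bound: "\<bar>F (k * m + r) z - u\<bar> \<le> c ^ k" if "z \<in> carrier G" for k r z
    using that
  proof (induction k arbitrary: z)
    case 0
    have "F r z \<le> (\<Sum>y\<in>carrier G. F r y)" using 0 fin nonneg by (intro member_le_sum) auto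
    then have "F r z \<le> 1" by (simp add: total)
    moreover have "0 \<le> u" "u \<le> 1" using card_pos by (auto simp: u_def)
    ultimately show ?case using nonneg[OF 0, of r] by simp
  next
    case (Suc k)
    let ?n = "k * m + r"
    let ?h = "\<lambda>y. F ?n (inv y \<otimes> z) - u"
    have "(\<Sum>y\<in>carrier G. ?h y) = 0"
      using translate[OF Suc.prems, of "F ?n"] card_pos by (simp add: sum_subtractf total u_def)
    then have zero: "(\<Sum>y\<in>carrier G. \<epsilon> * ?h y) = 0" by (simp flip: sum_distrib_left)
    have "F (Suc k * m + r) z - u = (\<Sum>y\<in>carrier G. F m y * F ?n (inv y \<otimes> z)) - (\<Sum>y\<in>carrier G. F m y * u)"
      using conv[OF Suc.prems, of m ?n] by (simp add: add.assoc total flip: sum_distrib_right)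
    also have "\<dots> = (\<Sum>y\<in>carrier G. (F m y - \<epsilon>) * ?h y)"
      using zero by (simp add: left_diff_distrib right_diff_distrib sum_subtractf)
    finally have "\<bar>F (Suc k * m + r) z - u\<bar> \<le> (\<Sum>y\<in>carrier G. \<bar>(F m y - \<epsilon>) * ?h y\<bar>)" by simp
    also have "\<dots> \<le> (\<Sum>y\<in>carrier G. (F m y - \<epsilon>) * c ^ k)"
      unfolding abs_mult using Suc \<epsilon>_le by (intro sum_mono mult_mono) auto
    also have "\<dots> = c ^ Suc k" by (simp add: c_eq flip: sum_distrib_right)
    finally show ?case .
  qed
  have "(\<lambda>n. c ^ (n div m)) \<longlonglongrightarrow> 0"
  proof (rule filterlim_compose[where g="\<lambda>k. c ^ k"])
    show "(\<lambda>k. c ^ k) \<longlonglongrightarrow> 0" using c by (intro LIMSEQ_power_zero) simp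
    show "filterlim (\<lambda>n. n div m) sequentially sequentially"
      by (rule filterlim_at_top_div_const_nat) (use m in simp)
  qed
  then have "(\<lambda>n. F n x - u) \<longlonglongrightarrow> 0"
  proof (rule tendsto_0_le)
    show "\<forall>\<^sub>F n in sequentially. norm (F n x - u) \<le> norm (c ^ (n div m)) * 1"
      using bound[OF x, of "n div m" "n mod m" for n] c(1) by (simp add: div_mult_mod_eq)
  qed
  then show ?thesis by (simp add: u_def LIM_zero_iff)
qed

section \<open>Words with a given product\<close>

definition words :: "('a, 'b) monoid_scheme \<Rightarrow> 'a set \<Rightarrow> nat \<Rightarrow> 'a \<Rightarrow> 'a list set"
  where "words G C n x = {cs. length cs = n \<and> set cs \<subseteq> C \<and> list_product G cs = x}"

lemma finite_words: "finite C \<Longrightarrow> finite (words G C n x)"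
  by (rule finite_subset[OF _ finite_lists_length_eq[of C n]]) (auto simp: words_def)

lemma (in group) list_product_closed:
  "set xs \<subseteq> carrier G \<Longrightarrow> list_product G xs \<in> carrier G"
  by (induction xs) (auto simp: list_product_def)

lemma (in group) list_product_append:
  "set xs \<subseteq> carrier G \<Longrightarrow> set ys \<subseteq> carrier G
    \<Longrightarrow> list_product G (xs @ ys) = list_product G xs \<otimes> list_product G ys"
proof (induction xs)
  case Nil
  then show ?case using list_product_closed[of ys] by (simp add: list_product_def)
next
  case (Cons x xs)
  then show ?case
    using list_product_closed[of ys] list_product_closed[of xs]
    by (simp add: list_product_def m_assoc)
qed

text \<open>Cutting a word after \<open>m\<close> letters makes word counts multiply by convolution.\<close>

lemma (in group) card_words_add:
  assumes "finite (carrier G)" "C \<subseteq> carrier G" "x \<in> carrier G"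
  shows "card (words G C (m + n) x)
    = (\<Sum>y\<in>carrier G. card (words G C m y) * card (words G C n (inv y \<otimes> x)))"
proof -
  let ?S = "SIGMA y:carrier G. words G C m y \<times> words G C n (inv y \<otimes> x)"
  have fin: "finite C" using assms finite_subset by blast
  have "bij_betw (\<lambda>(y, us, vs). us @ vs) ?S (words G C (m + n) x)"
  proof (rule bij_betw_byWitness[where f' = "\<lambda>cs. (list_product G (take m cs), take m cs, drop m cs)"])
    show "\<forall>a\<in>?S. (\<lambda>cs. (list_product G (take m cs), take m cs, drop m cs)) ((\<lambda>(y, us, vs). us @ vs) a) = a"
      by (auto simp: words_def)
    show "\<forall>a'\<in>words G C (m + n) x. (\<lambda>(y, us, vs). us @ vs) (list_product G (take m a'), take m a', drop m a') = a'"
      by simp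
    show "(\<lambda>(y, us, vs). us @ vs) ` ?S \<subseteq> words G C (m + n) x"
    proof clarify
      fix y us vs assume y: "y \<in> carrier G" and us: "us \<in> words G C m y"
        and vs: "vs \<in> words G C n (inv y \<otimes> x)"
      then have "list_product G (us @ vs) = y \<otimes> (inv y \<otimes> x)"
        using assms(2) by (subst list_product_append) (auto simp: words_def)
      also have "\<dots> = x" using y assms(3) by (simp add: m_assoc[symmetric])
      finally show "us @ vs \<in> words G C (m + n) x" using us vs by (auto simp: words_def)
    qed
    show "(\<lambda>cs. (list_product G (take m cs), take m cs, drop m cs)) ` words G C (m + n) x \<subseteq> ?S"
    proof (rule image_subsetI)
      fix cs assume cs: "cs \<in> words G C (m + n) x"
      let ?u = "take m cs" and ?v = "drop m cs"
      have sets: "set ?u \<subseteq> C" "set ?v \<subseteq> C"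
        using cs set_take_subset[of m cs] set_drop_subset[of m cs] by (auto simp: words_def)
      then have clos: "list_product G ?u \<in> carrier G" "list_product G ?v \<in> carrier G"
        using assms(2) by (auto intro!: list_product_closed)
      have "x = list_product G ?u \<otimes> list_product G ?v"
        using cs sets assms(2) list_product_append[of ?u ?v] by (auto simp: words_def)
      then have "inv (list_product G ?u) \<otimes> x = list_product G ?v"
        using clos by (simp add: m_assoc[symmetric])
      then show "(list_product G ?u, ?u, ?v) \<in> ?S" using clos sets cs by (auto simp: words_def)
    qed
  qed
  then have "card (words G C (m + n) x) = card ?S" by (rule bij_betw_same_card[symmetric])
  also have "\<dots> = (\<Sum>y\<in>carrier G. card (words G C m y \<times> words G C n (inv y \<otimes> x)))"
    by (rule card_SigmaI) (use assms fin in \<open>auto intro!: finite_words\<close>)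
  finally show ?thesis by (simp add: card_cartesian_product)
qed

lemma (in group) sum_card_words:
  assumes "finite (carrier G)" "C \<subseteq> carrier G"
  shows "(\<Sum>x\<in>carrier G. card (words G C n x)) = card C ^ n"
proof -
  let ?L = "{cs. set cs \<subseteq> C \<and> length cs = n}"
  have fin: "finite C" using assms finite_subset by blast
  have "(\<Sum>x\<in>carrier G. card (words G C n x)) = card (\<Union>x\<in>carrier G. words G C n x)"
    by (rule card_UN_disjoint[symmetric]) (use assms fin finite_words in \<open>auto simp: words_def\<close>)
  also have "(\<Union>x\<in>carrier G. words G C n x) = ?L"
    using assms(2) list_product_closed by (auto simp: words_def)
  finally show ?thesis by (simp add: card_lists_length_eq[OF fin])
qed

section \<open>Words in a conjugacy class of the symmetric group\<close>

lemma cycle_type_conj: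
  assumes "p permutes {1..d}" "t permutes {1..d}"
  shows "cycle_type d (t \<circ> p \<circ> inv' t) = cycle_type d p"
proof -
  have perm: "permutation p" using assms(1) by (auto simp: permutation_permutes)
  have "orbit (t \<circ> p \<circ> inv' t) (t y) = t ` orbit p y" for y
    using permutes_inverses(2)[OF assms(2)]
    by (intro orbit_inverse[symmetric] permutation_self_in_orbit[OF perm]) simp
  then have "orbit (t \<circ> p \<circ> inv' t) ` t ` {1..d} = (\<lambda>X. t ` X) ` orbit p ` {1..d}"
    by (simp only: image_image)
  then have orbs: "orbit (t \<circ> p \<circ> inv' t) ` {1..d} = (\<lambda>X. t ` X) ` orbit p ` {1..d}"
    by (simp only: permutes_image[OF assms(2)])
  have inj: "inj t" by (rule permutes_inj[OF assms(2)])
  then have "mset_set ((\<lambda>X. t ` X) ` orbit p ` {1..d}) = image_mset (\<lambda>X. t ` X) (mset_set (orbit p ` {1..d}))"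
    by (intro image_mset_mset_set[symmetric]) (auto simp: inj_on_def inj_image_eq_iff)
  then show ?thesis
    unfolding cycle_type_def orbs by (simp add: multiset.map_comp comp_def card_image inj_on_subset[OF inj])
qed

lemma conj_closed_cycle_class: "conj_closed d (cycle_class d \<theta>)"
  unfolding conj_closed_def cycle_class_def
  by (auto simp: cycle_type_conj intro!: permutes_compose permutes_inv simp flip: comp_assoc)

lemma cycle_class_inv:
  assumes "p \<in> cycle_class d \<theta>"
  shows "inv' p \<in> cycle_class d \<theta>"
proof -
  have p: "p permutes {1..d}" "permutation p"
    using assms by (auto simp: cycle_class_def permutation_permutes)
  have "orbit (inv' p) = orbit p" using orbit_inv_eq[OF p(2)] by auto
  then show ?thesis using assms permutes_inv[OF p(1)] by (simp add: cycle_class_def cycle_type_def)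
qed

lemma cycle_class_subset: "cycle_class d \<theta> \<subseteq> carrier (sym_group d)"
  by (auto simp: cycle_class_def sym_group_carrier)

lemma cycle_type_id: "cycle_type d id = replicate_mset d 1"
proof (induction d)
  case 0
  then show ?case by (simp add: cycle_type_def)
next
  case (Suc d)
  then show ?case by (simp only: cycle_type_Suc_fixed[OF permutes_id] replicate_mset_Suc)
qed

lemma finite_carrier_sym_group: "finite (carrier (sym_group d))"
  using finite_permutations[of "{1..d}"] by (simp add: sym_group_def)

lemma cycle_class_nonempty:
  assumes "number_partition d \<theta>"
  shows "cycle_class d \<theta> \<noteq> {}"
  using card_cycle_class[OF assms] z_partition_pos[OF assms] by auto

lemma card_cycle_class_pos:
  assumes "number_partition d \<theta>"
  shows "0 < card (cycle_class d \<theta>)"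
  using cycle_class_nonempty[OF assms] finite_cycle_class by (simp add: card_gt_0_iff)

lemma list_product_Cons:
  "list_product (sym_group d) (p # ps) = p \<circ> list_product (sym_group d) ps"
  by (simp only: list_product_def foldr.simps comp_apply sym_group_mult)

lemma sign_list_product:
  assumes "set ps \<subseteq> carrier (sym_group d)"
  shows "sign (list_product (sym_group d) ps) = (\<Prod>p\<leftarrow>ps. sign p)"
  using assms
proof (induction ps)
  case Nil
  then show ?case by (simp add: list_product_def sym_group_one)
next
  case (Cons p ps)
  interpret group "sym_group d" by (rule sym_group_is_group)
  have "sign (p \<circ> list_product (sym_group d) ps) = sign p * sign (list_product (sym_group d) ps)"
    using Cons.prems list_product_closed[of ps] by (intro sign_compose) (auto intro: sym_group_carrier')
  then show ?case using Cons by (simp only: list_product_Cons) simp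
qed

lemma sign_cycle_class:
  assumes "p \<in> cycle_class d \<theta>"
  shows "sign p = (-1) ^ nat (colength \<theta>)"
  using sign_eq_colength[of p d] assms by (auto simp: cycle_class_def)

lemma sign_word:
  assumes "cs \<in> words (sym_group d) (cycle_class d \<theta>) n x"
  shows "sign x = ((-1) ^ nat (colength \<theta>)) ^ n"
proof -
  have cs: "length cs = n" "set cs \<subseteq> cycle_class d \<theta>" "x = list_product (sym_group d) cs"
    using assms by (auto simp: words_def)
  have "map sign cs = replicate n ((-1) ^ nat (colength \<theta>))"
    using cs(1,2) sign_cycle_class by (intro replicate_eqI) auto
  then show ?thesis
    using cs sign_list_product[of cs d] cycle_class_subset[of d \<theta>] by (auto simp: prod_list_replicate)
qed

text \<open>For \<open>c\<close> in the class with \<open>c a \<noteq> a\<close>, conjugation by the transposition of \<open>c a\<close> with a third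
  point \<open>e\<close> gives an element that sends \<open>a\<close> to \<open>e\<close>.\<close>

lemma cycle_class_two_elements:
  assumes "d \<ge> 3" "number_partition d \<nu>" "\<nu> \<noteq> replicate_mset d 1"
  shows "\<exists>c c'. c \<in> cycle_class d \<nu> \<and> c' \<in> cycle_class d \<nu> \<and> c \<noteq> c'"
proof -
  obtain c where c: "c \<in> cycle_class d \<nu>" using cycle_class_nonempty[OF assms(2)] by auto
  then have p: "c permutes {1..d}" by (simp add: cycle_class_def)
  have "c \<noteq> id" using c assms(3) cycle_type_id[of d] by (auto simp: cycle_class_def)
  then obtain a where a: "c a \<noteq> a" by (auto simp: fun_eq_iff)
  then have aS: "a \<in> {1..d}" using p by (auto simp: permutes_def)
  then have bS: "c a \<in> {1..d}" using p by (simp only: permutes_in_image)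
  have "card {a, c a} < card {1..d}" using assms(1) a by simp
  then obtain e where e: "e \<in> {1..d}" "e \<noteq> a" "e \<noteq> c a"
    by (metis card_mono finite.emptyI finite.insertI insert_iff linorder_not_less subsetI)
  let ?t = "transpose (c a) e"
  have "?t permutes {1..d}" using bS e by (simp only: permutes_swap_id)
  then have "?t \<circ> c \<circ> inv' ?t \<in> cycle_class d \<nu>"
    using conj_closed_cycle_class[of d \<nu>] c unfolding conj_closed_def by blast
  moreover have "(?t \<circ> c \<circ> inv' ?t) a = e" using a e by (simp add: inv_unique_comp)
  then have "?t \<circ> c \<circ> inv' ?t \<noteq> c" using e by metis
  ultimately show ?thesis using c by metis
qed

lemma words_append:
  assumes "C \<subseteq> carrier (sym_group d)"
    and "us \<in> words (sym_group d) C m x" "vs \<in> words (sym_group d) C n y"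
  shows "us @ vs \<in> words (sym_group d) C (m + n) (x \<circ> y)"
proof -
  interpret group "sym_group d" by (rule sym_group_is_group)
  show ?thesis using assms list_product_append[of us vs] by (auto simp: words_def sym_group_mult)
qed

lemma words_inv:
  assumes "C \<subseteq> carrier (sym_group d)" "\<And>c. c \<in> C \<Longrightarrow> inv' c \<in> C"
    and "cs \<in> words (sym_group d) C n x"
  shows "words (sym_group d) C n (inv' x) \<noteq> {}"
  using assms(3)
proof (induction cs arbitrary: n x)
  case Nil
  then have "[] \<in> words (sym_group d) C n (inv' x)"
    by (auto simp: words_def list_product_def sym_group_one)
  then show ?case by blast
next
  case (Cons c cs)
  interpret group "sym_group d" by (rule sym_group_is_group)
  let ?y = "list_product (sym_group d) cs"
  from Cons.prems have c: "c \<in> C" and cs: "cs \<in> words (sym_group d) C (length cs) ?y"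
    and n: "n = length cs + 1" and x: "x = c \<circ> ?y"
    by (auto simp: words_def list_product_def sym_group_mult)
  obtain cs' where "cs' \<in> words (sym_group d) C (length cs) (inv' ?y)" using Cons.IH[OF cs] by auto
  moreover have "[inv' c] \<in> words (sym_group d) C 1 (inv' c)"
    using assms(2)[OF c] by (simp add: words_def list_product_def sym_group_one sym_group_mult)
  ultimately have "cs' @ [inv' c] \<in> words (sym_group d) C n (inv' ?y \<circ> inv' c)"
    unfolding n by (rule words_append[OF assms(1)])
  moreover have "bij c" "bij ?y"
    using c assms(1) cs list_product_closed[of cs]
    by (auto simp: sym_group_carrier words_def intro!: permutes_bij)
  then have "inv' x = inv' ?y \<circ> inv' c" unfolding x by (rule o_inv_distrib)
  ultimately show ?case by (metis empty_iff)
qed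

lemma words_conj:
  assumes "C \<subseteq> carrier (sym_group d)" "conj_closed d C" "t permutes {1..d}"
    and "cs \<in> words (sym_group d) C n x"
  shows "words (sym_group d) C n (t \<circ> x \<circ> inv' t) \<noteq> {}"
proof -
  let ?f = "\<lambda>c. t \<circ> c \<circ> inv' t"
  have t: "inv' t \<circ> t = id" "t \<circ> inv' t = id" using permutes_inv_o[OF assms(3)] by auto
  have "list_product (sym_group d) (map ?f cs) = ?f (list_product (sym_group d) cs)"
  proof (induction cs)
    case Nil
    then show ?case by (simp add: list_product_def sym_group_one t)
  next
    case (Cons c cs)
    have "?f c \<circ> ?f y = ?f (c \<circ> y)" for y
      using t(1) by (metis (no_types, opaque_lifting) comp_assoc comp_id)
    then show ?case using Cons by (simp only: list_product_Cons list.map)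
  qed
  then have "map ?f cs \<in> words (sym_group d) C n (?f x)"
    using assms(2-4) by (auto simp: words_def conj_closed_def)
  then show ?thesis by blast
qed

text \<open>The class is closed under inverses, so \<open>c c\<^sup>-\<^sup>1\<close> can be appended to a word without changing its
  product. The sets \<open>P k\<close> of products of words of length \<open>2 k\<close> therefore increase, and their union
  is a normal subgroup. It is not trivial, as it contains \<open>c c'\<^sup>-\<^sup>1\<close> for two different elements of
  the class. So it contains the finite set \<open>A\<^sub>d\<close>, and one \<open>P m\<close> does so already.\<close>

lemma alternating_as_even_words:
  assumes "d \<ge> 5" "number_partition d \<nu>" "\<nu> \<noteq> replicate_mset d 1"
  shows "\<exists>m>0. \<forall>x\<in>carrier (alt_group d). words (sym_group d) (cycle_class d \<nu>) (m + m) x \<noteq> {}"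
proof -
  let ?G = "sym_group d" and ?C = "cycle_class d \<nu>"
  define P where "P k = {x. words ?G ?C (k + k) x \<noteq> {}}" for k
  have add: "x \<circ> y \<in> P (k + l)" if xy: "x \<in> P k" "y \<in> P l" for x y k l
  proof -
    obtain us vs where "us \<in> words ?G ?C (k + k) x" "vs \<in> words ?G ?C (l + l) y"
      using xy by (auto simp: P_def)
    from words_append[OF cycle_class_subset this] show ?thesis by (auto simp: P_def add_ac)
  qed
  have sub: "P k \<subseteq> carrier ?G" for k
    using group.list_product_closed[OF sym_group_is_group] cycle_class_subset[of d \<nu>]
    by (fastforce simp: P_def words_def)
  have one: "id \<in> P 0" by (auto simp: P_def words_def list_product_def sym_group_one)
  have two: "c \<circ> c' \<in> P 1" if "c \<in> ?C" "c' \<in> ?C" for c c'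
  proof -
    have "[c, c'] \<in> words ?G ?C (1 + 1) (c \<circ> c')"
      using that by (simp add: words_def list_product_def sym_group_mult sym_group_one)
    then show ?thesis by (auto simp: P_def)
  qed
  have mono: "mono P"
  proof (rule monoI)
    obtain c where c: "c \<in> ?C" using cycle_class_nonempty[OF assms(2)] by auto
    then have "c permutes {1..d}" by (simp add: cycle_class_def)
    then have "id \<in> P 1" using two[OF c cycle_class_inv[OF c]] by (simp add: permutes_inv_o)
    then have "P k \<subseteq> P (Suc k)" for k using add[of _ k id 1] by auto
    then show "P k \<subseteq> P l" if "k \<le> l" for k l using lift_Suc_mono_le[of P, OF _ that] by simp
  qed
  define N where "N = (\<Union>k. P k)"
  have N_inv: "inv' x \<in> N" if "x \<in> N" for x
    using that words_inv[OF cycle_class_subset cycle_class_inv] by (fastforce simp: N_def P_def)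
  have "subgroup N ?G"
  proof
    show "N \<subseteq> carrier ?G" using sub by (auto simp: N_def)
    show "x \<otimes>\<^bsub>?G\<^esub> y \<in> N" if "x \<in> N" "y \<in> N" for x y
      using that add unfolding N_def sym_group_mult by blast
    show "\<one>\<^bsub>?G\<^esub> \<in> N" using one by (auto simp: N_def sym_group_one)
    show "inv\<^bsub>?G\<^esub> x \<in> N" if "x \<in> N" for x
    proof -
      have "x \<in> carrier ?G" using that sub by (auto simp: N_def)
      then show ?thesis using N_inv[OF that] by simp
    qed
  qed
  moreover have "conj_closed d N"
    using words_conj[OF cycle_class_subset conj_closed_cycle_class]
    unfolding conj_closed_def N_def P_def by fast
  moreover obtain c c' where c: "c \<in> ?C" "c' \<in> ?C" "c \<noteq> c'"
    using cycle_class_two_elements[of d \<nu>] assms by auto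
  have "c \<circ> inv' c' \<in> N" using two[OF c(1) cycle_class_inv[OF c(2)]] by (auto simp: N_def)
  moreover have "c \<circ> inv' c' \<noteq> id"
  proof
    assume eq: "c \<circ> inv' c' = id"
    have "c' permutes {1..d}" using c(2) by (simp add: cycle_class_def)
    then have "c = c \<circ> inv' c' \<circ> c'" by (simp add: comp_assoc permutes_inv_o)
    then show False using eq c(3) by simp
  qed
  ultimately have "carrier (alt_group d) \<subseteq> N" by (rule alternating_subset_normal[OF assms(1)])
  then have "\<forall>x\<in>carrier (alt_group d). \<exists>k. x \<in> P k" by (auto simp: N_def)
  then obtain k where k: "\<And>x. x \<in> carrier (alt_group d) \<Longrightarrow> x \<in> P (k x)" by metis
  have "carrier (alt_group d) \<subseteq> carrier ?G" by (auto simp: alt_group_carrier sym_group_carrier)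
  then have fin: "finite (carrier (alt_group d))" using finite_carrier_sym_group finite_subset by blast
  define m where "m = Suc (Max (k ` carrier (alt_group d)))"
  have "x \<in> P m" if "x \<in> carrier (alt_group d)" for x
  proof -
    have "k x \<le> m" using fin that by (simp add: m_def le_SucI)
    then show ?thesis using monoD[OF mono] k[OF that] by blast
  qed
  then show ?thesis by (intro exI[of _ m]) (auto simp: m_def P_def)
qed

text \<open>The distribution after \<open>n\<close> steps of the random walk that starts at the identity and
  multiplies by a uniformly chosen element of the class in each step.\<close>

definition word_density :: "nat \<Rightarrow> nat multiset \<Rightarrow> nat \<Rightarrow> (nat \<Rightarrow> nat) \<Rightarrow> real"
  where "word_density d \<nu> n x
    = card (words (sym_group d) (cycle_class d \<nu>) n x) / card (cycle_class d \<nu>) ^ n"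

lemma word_density_add:
  assumes "x permutes {1..d}"
  shows "word_density d \<nu> (m + n) x
    = (\<Sum>y\<in>carrier (sym_group d). word_density d \<nu> m y * word_density d \<nu> n (inv' y \<circ> x))"
proof -
  interpret group "sym_group d" by (rule sym_group_is_group)
  let ?w = "words (sym_group d) (cycle_class d \<nu>)"
  have "card (?w (m + n) x) = (\<Sum>y\<in>carrier (sym_group d). card (?w m y) * card (?w n (inv' y \<circ> x)))"
    using assms card_words_add[OF finite_carrier_sym_group cycle_class_subset, of x]
    by (simp add: sym_group_carrier sym_group_mult)
  then show ?thesis
    by (simp add: word_density_def power_add sum_divide_distrib)
qed

lemma word_density_eq_0:
  assumes "sign x \<noteq> ((-1) ^ nat (colength \<nu>)) ^ n"
  shows "word_density d \<nu> n x = 0"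
proof -
  have "words (sym_group d) (cycle_class d \<nu>) n x = {}" using sign_word assms by blast
  then show ?thesis by (simp add: word_density_def)
qed

lemma sum_word_density:
  assumes "number_partition d \<nu>"
  shows "(\<Sum>x\<in>carrier (sym_group d). word_density d \<nu> n x) = 1"
proof -
  interpret group "sym_group d" by (rule sym_group_is_group)
  have "(\<Sum>x\<in>carrier (sym_group d). real (card (words (sym_group d) (cycle_class d \<nu>) n x)))
      = real (card (cycle_class d \<nu>) ^ n)"
    using sum_card_words[OF finite_carrier_sym_group cycle_class_subset, where n=n] by (simp flip: of_nat_sum)
  then show ?thesis
    using card_cycle_class_pos[OF assms] by (simp add: word_density_def flip: sum_divide_distrib)
qed

lemma alt_carrier_iff_sign: "x \<in> carrier (alt_group d) \<longleftrightarrow> x permutes {1..d} \<and> sign x = 1"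
  by (auto simp: alt_group_carrier sign_def)

text \<open>Words of even length only reach the alternating group, so their densities form a convolution
  semigroup of probability distributions there.\<close>

lemma word_density_even:
  assumes "d \<ge> 5" "number_partition d \<nu>" "\<nu> \<noteq> replicate_mset d 1"
    and x: "x permutes {1..d}" "sign x = 1"
  shows "(\<lambda>k. word_density d \<nu> (k + k) x) \<longlonglongrightarrow> 2 / fact d"
proof -
  let ?A = "alt_group d"
  interpret A: group ?A by (rule alt_group_is_group)
  have sub: "carrier ?A \<subseteq> carrier (sym_group d)" by (auto simp: alt_group_carrier sym_group_carrier)
  have fin: "finite (carrier ?A)" by (rule finite_subset[OF sub finite_carrier_sym_group])
  have s1: "((-1) ^ nat (colength \<nu>)) ^ (k + k) = (1::int)" for k
    by (simp add: power_add flip: power_mult_distrib)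
  have zero: "word_density d \<nu> (k + k) y = 0" if "y \<in> carrier (sym_group d) - carrier ?A" for k y
    using that word_density_eq_0[of y \<nu> "k + k" d] by (simp add: s1 alt_carrier_iff_sign sym_group_carrier)
  obtain m where m: "m > 0" "\<And>x. x \<in> carrier ?A \<Longrightarrow> words (sym_group d) (cycle_class d \<nu>) (m + m) x \<noteq> {}"
    using alternating_as_even_words[OF assms(1-3)] by auto
  have "(\<lambda>k. word_density d \<nu> (k + k) x) \<longlonglongrightarrow> 1 / card (carrier ?A)"
  proof (rule A.convolution_semigroup_equidistributes[where F="\<lambda>k. word_density d \<nu> (k + k)", OF fin _ _ _ m(1)])
    show "0 \<le> word_density d \<nu> (k + k) y" for k y by (simp add: word_density_def)
    show "(\<Sum>y\<in>carrier ?A. word_density d \<nu> (k + k) y) = 1" for k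
      using sum_word_density[OF assms(2), of "k + k"]
        sum.mono_neutral_left[OF finite_carrier_sym_group sub, of "word_density d \<nu> (k + k)"] zero by auto
    show "word_density d \<nu> (k + l + (k + l)) z = (\<Sum>y\<in>carrier ?A. word_density d \<nu> (k + k) y *
        word_density d \<nu> (l + l) (inv\<^bsub>?A\<^esub> y \<otimes>\<^bsub>?A\<^esub> z))" if "z \<in> carrier ?A" for k l z
    proof -
      have "word_density d \<nu> ((k + k) + (l + l)) z = (\<Sum>y\<in>carrier (sym_group d). word_density d \<nu> (k + k) y *
          word_density d \<nu> (l + l) (inv' y \<circ> z))"
        using that by (intro word_density_add) (simp add: alt_group_carrier)
      also have "\<dots> = (\<Sum>y\<in>carrier ?A. word_density d \<nu> (k + k) y * word_density d \<nu> (l + l) (inv' y \<circ> z))"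
        by (rule sum.mono_neutral_right[OF finite_carrier_sym_group sub]) (use zero in auto)
      also have "\<dots> = (\<Sum>y\<in>carrier ?A. word_density d \<nu> (k + k) y *
          word_density d \<nu> (l + l) (inv\<^bsub>?A\<^esub> y \<otimes>\<^bsub>?A\<^esub> z))"
        by (intro sum.cong) (simp_all add: alt_group_inv_equality alt_group_mult)
      finally show ?thesis by (simp add: add_ac)
    qed
    show "0 < word_density d \<nu> (m + m) y" if "y \<in> carrier ?A" for y
    proof -
      have "0 < card (words (sym_group d) (cycle_class d \<nu>) (m + m) y)"
        using m(2)[OF that] by (simp add: card_gt_0_iff finite_words finite_cycle_class)
      then show ?thesis
        unfolding word_density_def using card_cycle_class_pos[OF assms(2)] by (intro divide_pos_pos) simp_all
    qed
    show "x \<in> carrier ?A" using x by (simp add: alt_carrier_iff_sign)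
  qed
  moreover have "fact d = 2 * real (card (carrier ?A))"
    using arg_cong[OF alt_group_card_carrier[of d], of real] assms(1) by simp
  then have "1 / real (card (carrier ?A)) = 2 / fact d" by simp
  ultimately show ?thesis by simp
qed

text \<open>Condition on the first letter: what remains is a word of even length.\<close>

lemma word_density_odd:
  assumes "d \<ge> 5" "number_partition d \<nu>" "\<nu> \<noteq> replicate_mset d 1"
    and x: "x permutes {1..d}" "sign x = (-1) ^ nat (colength \<nu>)"
  shows "(\<lambda>k. word_density d \<nu> (Suc (k + k)) x) \<longlonglongrightarrow> 2 / fact d"
proof -
  let ?C = "cycle_class d \<nu>"
  have "(\<lambda>k. \<Sum>c\<in>?C. 1 / card ?C * word_density d \<nu> (k + k) (inv' c \<circ> x)) \<longlonglongrightarrow> (\<Sum>c\<in>?C. 1 / card ?C * (2 / fact d))"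
  proof (intro tendsto_sum tendsto_mult_left word_density_even[OF assms(1-3)])
    fix c assume c: "c \<in> ?C"
    then have perm: "c permutes {1..d}" by (simp add: cycle_class_def)
    then show "inv' c \<circ> x permutes {1..d}" using x(1) by (intro permutes_compose permutes_inv)
    have "permutation c" "permutation x" using perm x(1) by (auto simp: permutation_permutes)
    then show "sign (inv' c \<circ> x) = 1"
      using x(2) sign_cycle_class[OF c]
      by (simp add: sign_compose permutation_inverse sign_inverse flip: power_mult_distrib)
  qed
  moreover have "word_density d \<nu> (Suc (k + k)) x = (\<Sum>c\<in>?C. 1 / card ?C * word_density d \<nu> (k + k) (inv' c \<circ> x))" for k
  proof -
    have one: "words (sym_group d) ?C 1 y = (if y \<in> ?C then {[y]} else {})" for y
      by (auto simp: words_def list_product_def sym_group_one sym_group_mult length_Suc_conv)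
    have "word_density d \<nu> (1 + (k + k)) x = (\<Sum>y\<in>carrier (sym_group d).
        word_density d \<nu> 1 y * word_density d \<nu> (k + k) (inv' y \<circ> x))"
      by (rule word_density_add[OF x(1)])
    also have "\<dots> = (\<Sum>y\<in>?C. word_density d \<nu> 1 y * word_density d \<nu> (k + k) (inv' y \<circ> x))"
      by (rule sum.mono_neutral_right[OF finite_carrier_sym_group cycle_class_subset])
        (auto simp: word_density_def one simp del: One_nat_def)
    also have "\<dots> = (\<Sum>c\<in>?C. 1 / card ?C * word_density d \<nu> (k + k) (inv' c \<circ> x))"
      by (rule sum.cong) (simp_all add: word_density_def[of d \<nu> 1] one del: One_nat_def)
    finally show ?thesis by simp
  qed
  ultimately show ?thesis using card_cycle_class_pos[OF assms(2)] by simp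
qed

text \<open>The filter restricts to those lengths \<open>n\<close> for which words of length \<open>n\<close> have the sign of
  \<open>x\<close>; for all other \<open>n\<close> the density vanishes. If the class is even, odd and even \<open>n\<close> may both
  occur.\<close>

lemma word_density_tendsto:
  assumes "d \<ge> 5" "number_partition d \<nu>" "\<nu> \<noteq> replicate_mset d 1"
    and x: "x permutes {1..d}"
  shows "((\<lambda>n. word_density d \<nu> n x) \<longlongrightarrow> 2 / fact d)
    (inf sequentially (principal {n. sign x = ((-1) ^ nat (colength \<nu>)) ^ n}))"
proof (rule tendstoI)
  fix e :: real assume e: "e > 0"
  let ?s = "(-1) ^ nat (colength \<nu>) :: int"
  have ss: "?s ^ (k + k) = 1" for k by (simp add: power_add flip: power_mult_distrib)
  have "\<forall>\<^sub>F k in sequentially. sign x = 1 \<longrightarrow> dist (word_density d \<nu> (k + k) x) (2 / fact d) < e"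
    using tendstoD[OF word_density_even[OF assms] e] by (cases "sign x = 1") auto
  moreover have "\<forall>\<^sub>F k in sequentially. sign x = ?s \<longrightarrow> dist (word_density d \<nu> (Suc (k + k)) x) (2 / fact d) < e"
    using tendstoD[OF word_density_odd[OF assms] e] by (cases "sign x = ?s") auto
  ultimately have "\<forall>\<^sub>F k in sequentially.
      (sign x = 1 \<longrightarrow> dist (word_density d \<nu> (k + k) x) (2 / fact d) < e) \<and>
      (sign x = ?s \<longrightarrow> dist (word_density d \<nu> (Suc (k + k)) x) (2 / fact d) < e)"
    by (rule eventually_conj)
  then obtain K where K: "\<And>k. k \<ge> K \<Longrightarrow>
      (sign x = 1 \<longrightarrow> dist (word_density d \<nu> (k + k) x) (2 / fact d) < e) \<and>
      (sign x = ?s \<longrightarrow> dist (word_density d \<nu> (Suc (k + k)) x) (2 / fact d) < e)"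
    unfolding eventually_sequentially by blast
  have "dist (word_density d \<nu> n x) (2 / fact d) < e" if n: "n \<ge> Suc (K + K)" "sign x = ?s ^ n" for n
  proof (cases "even n")
    case True
    then obtain k where k: "n = k + k" by (metis evenE mult_2)
    then show ?thesis using K[of k] n ss[of k] by simp
  next
    case False
    then obtain k where k: "n = Suc (k + k)" by (metis oddE mult_2 Suc_eq_plus1)
    then show ?thesis using K[of k] n ss[of k] by simp
  qed
  then show "\<forall>\<^sub>F n in inf sequentially (principal {n. sign x = ?s ^ n}).
      dist (word_density d \<nu> n x) (2 / fact d) < e"
    unfolding eventually_inf_principal eventually_sequentially by auto
qed

section \<open>Counting monodromy tuples by words\<close>

text \<open>The part of the monodromy data that does not grow with the genus, without the condition on
  the product; the generators need not act transitively.\<close>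

definition base_tuples ::
    "nat \<Rightarrow> nat \<Rightarrow> nat multiset list \<Rightarrow> ((nat \<Rightarrow> nat) list \<times> (nat \<Rightarrow> nat) list \<times> (nat \<Rightarrow> nat) list) set"
  where "base_tuples h d \<mu> =
    {as. set as \<subseteq> carrier (sym_group d) \<and> length as = h} \<times>
    {bs. set bs \<subseteq> carrier (sym_group d) \<and> length bs = h} \<times>
    {\<sigma>s. set \<sigma>s \<subseteq> carrier (sym_group d) \<and> map (cycle_type d) \<sigma>s = \<mu>}"

definition base_product ::
    "nat \<Rightarrow> (nat \<Rightarrow> nat) list \<times> (nat \<Rightarrow> nat) list \<times> (nat \<Rightarrow> nat) list \<Rightarrow> nat \<Rightarrow> nat"
  where "base_product d = (\<lambda>(as, bs, \<sigma>s).
    list_product (sym_group d) (map2 (group_commutator (sym_group d)) as bs @ \<sigma>s))"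

definition adjoin :: "('a \<times> 'b \<times> 'c list) \<times> 'c list \<Rightarrow> 'a \<times> 'b \<times> 'c list"
  where "adjoin = (\<lambda>((as, bs, \<sigma>s), ws). (as, bs, \<sigma>s @ ws))"

lemma bij_betw_lists_of_cycle_types_Cons:
  "bij_betw (\<lambda>(p, ps). p # ps)
    (cycle_class d \<theta> \<times> {\<sigma>s. set \<sigma>s \<subseteq> carrier (sym_group d) \<and> map (cycle_type d) \<sigma>s = \<mu>})
    {\<sigma>s. set \<sigma>s \<subseteq> carrier (sym_group d) \<and> map (cycle_type d) \<sigma>s = \<theta> # \<mu>}"
  by (rule bij_betw_byWitness[where f' = "\<lambda>ps. (hd ps, tl ps)"])
    (auto simp: cycle_class_def sym_group_carrier)

lemma card_lists_of_cycle_types: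
  "card {\<sigma>s. set \<sigma>s \<subseteq> carrier (sym_group d) \<and> map (cycle_type d) \<sigma>s = \<mu>}
    = (\<Prod>\<theta>\<leftarrow>\<mu>. card (cycle_class d \<theta>))"
proof (induction \<mu>)
  case Nil
  have "{\<sigma>s. set \<sigma>s \<subseteq> carrier (sym_group d) \<and> map (cycle_type d) \<sigma>s = []} = {[]}" by auto
  then show ?case by simp
next
  case (Cons \<theta> \<mu>)
  show ?case
    using bij_betw_same_card[OF bij_betw_lists_of_cycle_types_Cons[of d \<theta> \<mu>]] Cons.IH
    by (simp add: card_cartesian_product)
qed

lemma finite_lists_of_cycle_types:
  "finite {\<sigma>s. set \<sigma>s \<subseteq> carrier (sym_group d) \<and> map (cycle_type d) \<sigma>s = \<mu>}"
  by (rule finite_subset[OF _ finite_lists_length_eq[OF finite_carrier_sym_group, of d "length \<mu>"]]) auto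

lemma finite_base_tuples: "finite (base_tuples h d \<mu>)"
  unfolding base_tuples_def
  by (intro finite_cartesian_product finite_lists_of_cycle_types finite_lists_length_eq finite_carrier_sym_group)

lemma card_base_tuples:
  "card (base_tuples h d \<mu>) = fact d ^ h * (fact d ^ h * (\<Prod>\<theta>\<leftarrow>\<mu>. card (cycle_class d \<theta>)))"
  unfolding base_tuples_def card_cartesian_product card_lists_of_cycle_types
    card_lists_length_eq[OF finite_carrier_sym_group] sym_group_card_carrier ..

lemma group_commutator_sym_group:
  assumes "a \<in> carrier (sym_group d)" "b \<in> carrier (sym_group d)"
  shows "group_commutator (sym_group d) a b \<in> carrier (sym_group d)"
    and "sign (group_commutator (sym_group d) a b) = 1"
proof -
  interpret group "sym_group d" by (rule sym_group_is_group)
  show "group_commutator (sym_group d) a b \<in> carrier (sym_group d)"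
    using assms by (simp only: group_commutator_def m_closed inv_closed)
  have "permutation a" "permutation b" using assms by (auto intro: sym_group_carrier')
  then have "sign (a \<circ> b \<circ> inv' a \<circ> inv' b) = 1"
    by (simp add: sign_compose permutation_compose permutation_inverse sign_inverse algebra_simps)
  then show "sign (group_commutator (sym_group d) a b) = 1"
    using assms by (simp only: group_commutator_def sym_group_mult sym_group_inv_equality)
qed

lemma base_list_carrier:
  assumes "(as, bs, \<sigma>s) \<in> base_tuples h d \<mu>"
  shows "set (map2 (group_commutator (sym_group d)) as bs @ \<sigma>s) \<subseteq> carrier (sym_group d)"
proof
  have sub: "set as \<subseteq> carrier (sym_group d)" "set bs \<subseteq> carrier (sym_group d)" "set \<sigma>s \<subseteq> carrier (sym_group d)"
    using assms by (simp_all add: base_tuples_def)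
  fix c assume "c \<in> set (map2 (group_commutator (sym_group d)) as bs @ \<sigma>s)"
  then consider "c \<in> set \<sigma>s"
    | a b where "(a, b) \<in> set (zip as bs)" "c = group_commutator (sym_group d) a b"
    by auto
  then show "c \<in> carrier (sym_group d)"
  proof cases
    case 2
    then have "a \<in> carrier (sym_group d)" "b \<in> carrier (sym_group d)"
      using sub by (auto dest: set_zip_leftD set_zip_rightD)
    then show ?thesis unfolding 2(2) by (rule group_commutator_sym_group(1))
  qed (use sub in auto)
qed

lemma base_product_closed:
  assumes "t \<in> base_tuples h d \<mu>"
  shows "base_product d t \<in> carrier (sym_group d)"
proof -
  obtain as bs \<sigma>s where t: "t = (as, bs, \<sigma>s)" by (cases t)
  show ?thesis
    unfolding t base_product_def prod.case
    by (rule group.list_product_closed[OF sym_group_is_group base_list_carrier[OF assms[unfolded t]]])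
qed

text \<open>Commutators are even.\<close>

lemma sign_base_product:
  assumes "t \<in> base_tuples h d \<mu>"
  shows "sign (base_product d t) = (\<Prod>\<theta>\<leftarrow>\<mu>. (-1) ^ nat (colength \<theta>))"
proof -
  obtain as bs \<sigma>s where t: "t = (as, bs, \<sigma>s)" by (cases t)
  let ?K = "map2 (group_commutator (sym_group d)) as bs"
  have \<sigma>s: "set \<sigma>s \<subseteq> carrier (sym_group d)" "map (cycle_type d) \<sigma>s = \<mu>"
    and ab: "set as \<subseteq> carrier (sym_group d)" "set bs \<subseteq> carrier (sym_group d)"
    using assms by (auto simp: t base_tuples_def)
  have "sign c = 1" if c: "c \<in> set ?K" for c
  proof -
    obtain a b where "(a, b) \<in> set (zip as bs)" "c = group_commutator (sym_group d) a b"
      using c by auto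
    then show ?thesis
      using ab group_commutator_sym_group(2)[of a d b] set_zip_leftD[of a b as bs] set_zip_rightD[of a b as bs]
      by blast
  qed
  then have "map sign ?K = replicate (length ?K) 1" by (intro replicate_eqI) auto
  then have K: "prod_list (map sign ?K) = 1" by (simp only: prod_list_replicate power_one)
  have "map sign \<sigma>s = map (\<lambda>\<theta>. (-1) ^ nat (colength \<theta>)) (map (cycle_type d) \<sigma>s)"
    using \<sigma>s(1) sign_eq_colength by (auto simp: sym_group_carrier)
  then have "prod_list (map sign \<sigma>s) = (\<Prod>\<theta>\<leftarrow>\<mu>. (-1) ^ nat (colength \<theta>))" by (simp only: \<sigma>s(2))
  moreover have "sign (base_product d t) = prod_list (map sign (?K @ \<sigma>s))"
    using base_list_carrier assms sign_list_product[of "?K @ \<sigma>s" d]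
    by (simp only: t base_product_def prod.case)
  ultimately show ?thesis using K by (simp only: map_append prod_list.append mult_1)
qed

definition relation_tuples ::
    "nat \<Rightarrow> nat \<Rightarrow> nat multiset list \<Rightarrow> ((nat \<Rightarrow> nat) list \<times> (nat \<Rightarrow> nat) list \<times> (nat \<Rightarrow> nat) list) set"
  where "relation_tuples h d \<theta>s = {t \<in> base_tuples h d \<theta>s. base_product d t = id}"

lemma monodromy_tuples_eq:
  "monodromy_tuples h d \<theta>s = {(as, bs, \<sigma>s) \<in> relation_tuples h d \<theta>s.
     \<forall>x\<in>{1..d}. \<forall>y\<in>{1..d}. \<exists>p\<in>generate (sym_group d) (set as \<union> set bs \<union> set \<sigma>s). p x = y}"
  unfolding monodromy_tuples_def relation_tuples_def base_tuples_def base_product_def sym_group_one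
  by auto

lemma base_product_adjoin:
  assumes "t \<in> base_tuples h d \<mu>" "set ws \<subseteq> carrier (sym_group d)"
  shows "base_product d (adjoin (t, ws)) = base_product d t \<circ> list_product (sym_group d) ws"
proof -
  obtain as bs \<sigma>s where t: "t = (as, bs, \<sigma>s)" by (cases t)
  show ?thesis
    using group.list_product_append[OF sym_group_is_group base_list_carrier[OF assms(1)[unfolded t]] assms(2)]
    by (simp only: t adjoin_def base_product_def prod.case append_assoc sym_group_mult)
qed

lemma inverse_word_iff:
  assumes "w \<in> carrier (sym_group d)" "v \<in> carrier (sym_group d)"
  shows "w \<circ> v = id \<longleftrightarrow> v = inv' w"
proof
  have w: "w permutes {1..d}" using assms(1) by (simp only: sym_group_carrier)
  show "w \<circ> v = id" if "v = inv' w" unfolding that by (rule permutes_inv_o(1)[OF w])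
  assume "w \<circ> v = id"
  then have "inv' w \<circ> (w \<circ> v) = inv' w" by simp
  then show "v = inv' w" by (simp only: comp_assoc[symmetric] permutes_inv_o(2)[OF w] id_comp)
qed

text \<open>Given the base part, the relation of the surface group prescribes the product of the remaining
  \<open>n\<close> permutations, and nothing else constrains them within their class.\<close>

lemma bij_betw_adjoin:
  "bij_betw adjoin
    (SIGMA t:base_tuples h d \<mu>. words (sym_group d) (cycle_class d \<nu>) n (inv' (base_product d t)))
    (relation_tuples h d (\<mu> @ replicate n \<nu>))"
proof -
  let ?G = "sym_group d" and ?C = "cycle_class d \<nu>"
  let ?S = "SIGMA t:base_tuples h d \<mu>. words ?G ?C n (inv' (base_product d t))"
  let ?split = "\<lambda>(as, bs, \<sigma>s). ((as, bs, take (length \<mu>) \<sigma>s), drop (length \<mu>) \<sigma>s)"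
  have adj: "adjoin (t, ws) \<in> relation_tuples h d (\<mu> @ replicate n \<nu>) \<longleftrightarrow>
      ws \<in> words ?G ?C n (inv' (base_product d t))"
    if t: "t \<in> base_tuples h d \<mu>" and ws: "set ws \<subseteq> ?C" "length ws = n" for t ws
  proof -
    have ws': "set ws \<subseteq> carrier ?G" using ws(1) cycle_class_subset by blast
    have "map (cycle_type d) ws = replicate n \<nu>"
      using ws by (intro replicate_eqI) (auto simp: cycle_class_def)
    then have "adjoin (t, ws) \<in> base_tuples h d (\<mu> @ replicate n \<nu>)"
      using t ws' by (auto simp: base_tuples_def adjoin_def)
    then have "adjoin (t, ws) \<in> relation_tuples h d (\<mu> @ replicate n \<nu>)
        \<longleftrightarrow> base_product d t \<circ> list_product ?G ws = id"
      using base_product_adjoin[OF t ws'] by (simp add: relation_tuples_def)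
    also have "\<dots> \<longleftrightarrow> list_product ?G ws = inv' (base_product d t)"
      by (rule inverse_word_iff[OF base_product_closed[OF t] group.list_product_closed[OF sym_group_is_group ws']])
    finally show ?thesis using ws by (simp add: words_def)
  qed
  show ?thesis
  proof (rule bij_betw_byWitness[where f' = ?split])
    show "\<forall>a\<in>?S. ?split (adjoin a) = a"
      by (auto simp: adjoin_def base_tuples_def)
    show "\<forall>a\<in>relation_tuples h d (\<mu> @ replicate n \<nu>). adjoin (?split a) = a"
      by (auto simp: adjoin_def)
    show "adjoin ` ?S \<subseteq> relation_tuples h d (\<mu> @ replicate n \<nu>)"
      using adj by (auto simp: words_def)
    show "?split ` relation_tuples h d (\<mu> @ replicate n \<nu>) \<subseteq> ?S"
    proof (rule image_subsetI)
      fix a assume a: "a \<in> relation_tuples h d (\<mu> @ replicate n \<nu>)"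
      obtain as bs \<sigma>s where a_eq: "a = (as, bs, \<sigma>s)" by (cases a)
      let ?u = "take (length \<mu>) \<sigma>s" and ?v = "drop (length \<mu>) \<sigma>s"
      have \<sigma>s: "set \<sigma>s \<subseteq> carrier ?G" "map (cycle_type d) \<sigma>s = \<mu> @ replicate n \<nu>"
        using a by (auto simp: a_eq relation_tuples_def base_tuples_def)
      have u: "map (cycle_type d) ?u = \<mu>" and v: "map (cycle_type d) ?v = replicate n \<nu>"
        using \<sigma>s(2) by (simp_all flip: take_map drop_map)
      have sets: "set ?u \<subseteq> carrier ?G" "set ?v \<subseteq> carrier ?G"
        using \<sigma>s(1) set_take_subset[of _ \<sigma>s] set_drop_subset[of _ \<sigma>s] by blast+
      have len: "length ?v = n" using v by (metis length_map length_replicate)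
      have "cycle_type d p = \<nu>" if "p \<in> set ?v" for p
      proof -
        have "cycle_type d p \<in> set (map (cycle_type d) ?v)" using that by simp
        then show ?thesis unfolding v by simp
      qed
      then have v_sub: "set ?v \<subseteq> ?C" using sets(2) by (auto simp: cycle_class_def sym_group_carrier)
      have t: "(as, bs, ?u) \<in> base_tuples h d \<mu>"
        using a u sets(1) by (auto simp: a_eq relation_tuples_def base_tuples_def)
      have "adjoin ((as, bs, ?u), ?v) = a" by (simp add: adjoin_def a_eq)
      then show "?split a \<in> ?S" using adj[OF t v_sub len] t a by (simp add: a_eq)
    qed
  qed
qed

lemma card_relation_tuples:
  "card (relation_tuples h d (\<mu> @ replicate n \<nu>))
    = (\<Sum>t\<in>base_tuples h d \<mu>. card (words (sym_group d) (cycle_class d \<nu>) n (inv' (base_product d t))))"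
  unfolding bij_betw_same_card[OF bij_betw_adjoin, symmetric]
  by (rule card_SigmaI) (simp_all add: finite_base_tuples finite_words finite_cycle_class)

lemma finite_relation_tuples: "finite (relation_tuples h d \<theta>s)"
  by (rule finite_subset[OF _ finite_base_tuples]) (auto simp: relation_tuples_def)

section \<open>Tuples that are not transitive\<close>

text \<open>The set \<open>X\<close> is an orbit of the group generated by the tuple.\<close>

lemma not_transitive_invariant_subset:
  assumes t: "(as, bs, \<sigma>s) \<in> relation_tuples h d \<theta>s"
    and not_mono: "(as, bs, \<sigma>s) \<notin> monodromy_tuples h d \<theta>s"
  shows "\<exists>X. X \<subset> {1..d} \<and> X \<noteq> {} \<and> (\<forall>\<sigma>\<in>set \<sigma>s. \<sigma> ` X \<subseteq> X)"
proof -
  let ?S = "set as \<union> set bs \<union> set \<sigma>s"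
  interpret group "sym_group d" by (rule sym_group_is_group)
  have S: "?S \<subseteq> carrier (sym_group d)" using t by (auto simp: relation_tuples_def base_tuples_def)
  obtain x y where xy: "x \<in> {1..d}" "y \<in> {1..d}" "\<And>p. p \<in> generate (sym_group d) ?S \<Longrightarrow> p x \<noteq> y"
    using t not_mono by (auto simp: monodromy_tuples_eq)
  define X where "X = (\<lambda>p. p x) ` generate (sym_group d) ?S"
  have "X \<subseteq> {1..d}"
  proof
    fix z assume "z \<in> X"
    then obtain p where p: "p \<in> generate (sym_group d) ?S" "z = p x" by (auto simp: X_def)
    then have "p permutes {1..d}" using generate_in_carrier[OF S] by (simp add: sym_group_carrier)
    then show "z \<in> {1..d}" using xy(1) p(2) by (simp only: permutes_in_image)
  qed
  moreover have "y \<notin> X" using xy(3) by (auto simp: X_def)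
  moreover have "X \<noteq> {}" using generate.one by (auto simp: X_def)
  moreover have "\<sigma> ` X \<subseteq> X" if "\<sigma> \<in> set \<sigma>s" for \<sigma>
  proof (rule image_subsetI)
    fix z assume "z \<in> X"
    then obtain p where p: "p \<in> generate (sym_group d) ?S" "z = p x" by (auto simp: X_def)
    have "\<sigma> \<in> generate (sym_group d) ?S" using that by (intro generate.incl) simp
    then have "\<sigma> \<circ> p \<in> generate (sym_group d) ?S" using generate.eng[OF _ p(1)] by (simp only: sym_group_mult)
    moreover have "\<sigma> z = (\<sigma> \<circ> p) x" using p by simp
    ultimately show "\<sigma> z \<in> X" unfolding X_def by (intro image_eqI[where x = "\<sigma> \<circ> p"])
  qed
  ultimately show ?thesis using xy(2) by blast
qed

text \<open>Conjugating inside the class, one finds an element that sends a prescribed point of \<open>X\<close>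
  to a prescribed point outside \<open>X\<close>.\<close>

lemma card_class_stabilizer_less:
  assumes "number_partition d \<nu>" "\<nu> \<noteq> replicate_mset d 1" "X \<subset> {1..d}" "X \<noteq> {}"
  shows "card (cycle_class d \<nu> \<inter> {p. p ` X \<subseteq> X}) < card (cycle_class d \<nu>)"
proof (rule psubset_card_mono[OF finite_cycle_class])
  obtain c where c: "c \<in> cycle_class d \<nu>" using cycle_class_nonempty[OF assms(1)] by auto
  then have perm: "c permutes {1..d}" by (simp add: cycle_class_def)
  have "c \<noteq> id" using c assms(2) cycle_type_id[of d] by (auto simp: cycle_class_def)
  then obtain x where x: "c x \<noteq> x" by (auto simp: fun_eq_iff)
  then have xS: "x \<in> {1..d}" using perm by (auto simp: permutes_def)
  then have cxS: "c x \<in> {1..d}" using perm by (simp only: permutes_in_image)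
  obtain u v where uv: "u \<in> X" "v \<in> {1..d}" "v \<notin> X" using assms(3,4) by blast
  then have "u \<in> {1..d}" "u \<noteq> v" using assms(3) by auto
  then obtain t where t: "t permutes {1..d}" "map t [x, c x] = [u, v]"
    using exists_permutation_mapping_list[of "[x, c x]" "[u, v]" "{1..d}"] x xS cxS uv(2) by fastforce
  have "inv' t u = x" using t permutes_inverses(2)[OF t(1), of x] by simp
  then have "(t \<circ> c \<circ> inv' t) u = v" using t(2) by simp
  then have "t \<circ> c \<circ> inv' t \<notin> {p. p ` X \<subseteq> X}" using uv by blast
  moreover have "t \<circ> c \<circ> inv' t \<in> cycle_class d \<nu>"
    using conj_closed_cycle_class[of d \<nu>] c t(1) unfolding conj_closed_def by blast
  ultimately show "cycle_class d \<nu> \<inter> {p. p ` X \<subseteq> X} \<subset> cycle_class d \<nu>" by blast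
qed

lemma card_not_transitive_le:
  "card (relation_tuples h d (\<mu> @ replicate n \<nu>) - monodromy_tuples h d (\<mu> @ replicate n \<nu>))
    \<le> (\<Sum>X | X \<subset> {1..d} \<and> X \<noteq> {}. card (base_tuples h d \<mu>) * card (cycle_class d \<nu> \<inter> {p. p ` X \<subseteq> X}) ^ n)"
proof -
  let ?R = "relation_tuples h d (\<mu> @ replicate n \<nu>)" and ?M = "monodromy_tuples h d (\<mu> @ replicate n \<nu>)"
  let ?\<X> = "{X. X \<subset> {1..d} \<and> X \<noteq> {}}"
  let ?C = "\<lambda>X. cycle_class d \<nu> \<inter> {p. p ` X \<subseteq> X}"
  let ?L = "\<lambda>X. {ws. set ws \<subseteq> ?C X \<and> length ws = n}"
  have fin_C: "finite (?C X)" for X using finite_cycle_class by blast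
  have fin: "finite ?\<X>" by (rule finite_subset[of _ "Pow {1..d}"]) auto
  have fin_L: "finite (base_tuples h d \<mu> \<times> ?L X)" for X
    by (intro finite_cartesian_product finite_base_tuples finite_lists_length_eq fin_C)
  have "?R - ?M \<subseteq> (\<Union>X\<in>?\<X>. adjoin ` (base_tuples h d \<mu> \<times> ?L X))"
  proof
    fix a assume a: "a \<in> ?R - ?M"
    obtain as bs \<sigma>s where a_eq: "a = (as, bs, \<sigma>s)" by (cases a)
    have "(as, bs, \<sigma>s) \<in> ?R" "(as, bs, \<sigma>s) \<notin> ?M" using a by (simp_all add: a_eq)
    from not_transitive_invariant_subset[OF this]
    obtain X where X: "X \<in> ?\<X>" "\<forall>\<sigma>\<in>set \<sigma>s. \<sigma> ` X \<subseteq> X" by (elim exE conjE) simp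
    obtain t ws where t: "t \<in> base_tuples h d \<mu>" "ws \<in> words (sym_group d) (cycle_class d \<nu>) n (inv' (base_product d t))"
      and adj: "adjoin (t, ws) = a"
      using a unfolding bij_betw_imp_surj_on[OF bij_betw_adjoin, symmetric] by blast
    have "set ws \<subseteq> set \<sigma>s" using adj by (cases t) (auto simp: adjoin_def a_eq)
    then have "ws \<in> ?L X" using t(2) X(2) by (auto simp: words_def)
    then have "a \<in> adjoin ` (base_tuples h d \<mu> \<times> ?L X)" using t(1) adj by force
    then show "a \<in> (\<Union>X\<in>?\<X>. adjoin ` (base_tuples h d \<mu> \<times> ?L X))" using X(1) by blast
  qed
  then have "card (?R - ?M) \<le> card (\<Union>X\<in>?\<X>. adjoin ` (base_tuples h d \<mu> \<times> ?L X))"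
    by (rule card_mono[rotated]) (use fin fin_L in blast)
  also have "\<dots> \<le> (\<Sum>X\<in>?\<X>. card (adjoin ` (base_tuples h d \<mu> \<times> ?L X)))" by (rule card_UN_le[OF fin])
  also have "\<dots> \<le> (\<Sum>X\<in>?\<X>. card (base_tuples h d \<mu> \<times> ?L X))"
    by (intro sum_mono card_image_le fin_L)
  also have "\<dots> = (\<Sum>X\<in>?\<X>. card (base_tuples h d \<mu>) * card (?C X) ^ n)"
    by (simp only: card_cartesian_product card_lists_length_eq[OF fin_C])
  finally show ?thesis .
qed

lemma not_transitive_negligible:
  assumes "number_partition d \<nu>" "\<nu> \<noteq> replicate_mset d 1"
  shows "(\<lambda>n. card (relation_tuples h d (\<mu> @ replicate n \<nu>) - monodromy_tuples h d (\<mu> @ replicate n \<nu>))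
    / real (card (cycle_class d \<nu>)) ^ n) \<longlonglongrightarrow> 0"
proof (rule tendsto_sandwich[OF _ _ tendsto_const])
  let ?\<X> = "{X. X \<subset> {1..d} \<and> X \<noteq> {}}"
  let ?c = "real (card (cycle_class d \<nu>))"
  let ?b = "\<lambda>X. real (card (cycle_class d \<nu> \<inter> {p. p ` X \<subseteq> X}))"
  let ?T = "real (card (base_tuples h d \<mu>))"
  let ?f = "\<lambda>n. card (relation_tuples h d (\<mu> @ replicate n \<nu>) - monodromy_tuples h d (\<mu> @ replicate n \<nu>))"
  have c: "0 < ?c" using card_cycle_class_pos[OF assms(1)] by simp
  show "\<forall>\<^sub>F n in sequentially. 0 \<le> ?f n / ?c ^ n" by simp
  show "\<forall>\<^sub>F n in sequentially. ?f n / real (card (cycle_class d \<nu>)) ^ n \<le> (\<Sum>X\<in>?\<X>. ?T * (?b X / ?c) ^ n)"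
  proof (rule always_eventually, rule allI)
    fix n
    have "real (?f n) \<le> real (\<Sum>X\<in>?\<X>. card (base_tuples h d \<mu>) * card (cycle_class d \<nu> \<inter> {p. p ` X \<subseteq> X}) ^ n)"
      by (rule of_nat_mono[OF card_not_transitive_le])
    also have "\<dots> = (\<Sum>X\<in>?\<X>. ?T * ?b X ^ n)" by simp
    finally have "?f n / ?c ^ n \<le> (\<Sum>X\<in>?\<X>. ?T * ?b X ^ n) / ?c ^ n"
      using c by (intro divide_right_mono) auto
    then show "?f n / real (card (cycle_class d \<nu>)) ^ n \<le> (\<Sum>X\<in>?\<X>. ?T * (?b X / ?c) ^ n)"
      by (simp add: sum_divide_distrib power_divide)
  qed
  have "(\<lambda>n. \<Sum>X\<in>?\<X>. ?T * (?b X / ?c) ^ n) \<longlonglongrightarrow> (\<Sum>X\<in>?\<X>. ?T * 0)"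
  proof (intro tendsto_sum tendsto_mult_left LIMSEQ_power_zero)
    fix X assume "X \<in> ?\<X>"
    then have "?b X < ?c" using card_class_stabilizer_less[OF assms] by simp
    then show "norm (?b X / ?c) < 1" using c by simp
  qed
  then show "(\<lambda>n. \<Sum>X\<in>?\<X>. ?T * (?b X / ?c) ^ n) \<longlonglongrightarrow> 0" by simp
qed

section \<open>Asymptotics of the Hurwitz numbers\<close>

text \<open>Every base part contributes the limit \<open>2/d!\<close>, along the lengths \<open>n\<close> for which the signs of
  the \<open>\<sigma>s\<close> multiply to 1; the tuples that are not transitive are subtracted and vanish in the
  limit.\<close>

lemma monodromy_density_tendsto:
  assumes "d \<ge> 5" "number_partition d \<nu>" "\<nu> \<noteq> replicate_mset d 1"
  shows "((\<lambda>n. card (monodromy_tuples h d (\<mu> @ replicate n \<nu>)) / real (card (cycle_class d \<nu>)) ^ n)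
      \<longlongrightarrow> card (base_tuples h d \<mu>) * (2 / fact d))
    (inf sequentially (principal
      {n. (\<Prod>\<theta>\<leftarrow>\<mu>. (-1) ^ nat (colength \<theta>)) = (((-1) ^ nat (colength \<nu>)) ^ n :: int)}))"
    (is "(_ \<longlongrightarrow> _) ?F")
proof -
  let ?R = "\<lambda>n. relation_tuples h d (\<mu> @ replicate n \<nu>)" and ?M = "\<lambda>n. monodromy_tuples h d (\<mu> @ replicate n \<nu>)"
  let ?c = "real (card (cycle_class d \<nu>))"
  have sub: "?M n \<subseteq> ?R n" for n by (auto simp: monodromy_tuples_eq)
  have "real (card (?M n)) / ?c ^ n
      = (\<Sum>t\<in>base_tuples h d \<mu>. word_density d \<nu> n (inv' (base_product d t))) - card (?R n - ?M n) / ?c ^ n" for n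
  proof -
    have "card (?M n) + card (?R n - ?M n) = card (?R n)"
      using card_Diff_subset[OF finite_subset[OF sub finite_relation_tuples] sub]
        card_mono[OF finite_relation_tuples sub] by simp
    then have "real (card (?M n)) = real (card (?R n)) - real (card (?R n - ?M n))" by linarith
    then show ?thesis
      by (simp add: card_relation_tuples word_density_def diff_divide_distrib sum_divide_distrib)
  qed
  moreover have "((\<lambda>n. \<Sum>t\<in>base_tuples h d \<mu>. word_density d \<nu> n (inv' (base_product d t)))
      \<longlongrightarrow> (\<Sum>t\<in>base_tuples h d \<mu>. 2 / fact d)) ?F"
  proof (rule tendsto_sum)
    fix t assume t: "t \<in> base_tuples h d \<mu>"
    then have w: "base_product d t permutes {1..d}" using base_product_closed by (simp add: sym_group_carrier)
    then have "permutation (base_product d t)" by (auto simp: permutation_permutes)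
    then have "sign (inv' (base_product d t)) = (\<Prod>\<theta>\<leftarrow>\<mu>. (-1) ^ nat (colength \<theta>))"
      using sign_base_product[OF t] by (simp add: sign_inverse)
    then show "((\<lambda>n. word_density d \<nu> n (inv' (base_product d t))) \<longlongrightarrow> 2 / fact d) ?F"
      using word_density_tendsto[OF assms permutes_inv[OF w]] by simp
  qed
  moreover have "((\<lambda>n. card (?R n - ?M n) / ?c ^ n) \<longlongrightarrow> 0) ?F"
    by (rule tendsto_mono[OF inf_le1 not_transitive_negligible[OF assms(2,3)]])
  ultimately show ?thesis
    using tendsto_diff[of "\<lambda>n. \<Sum>t\<in>base_tuples h d \<mu>. word_density d \<nu> n (inv' (base_product d t))"] by fastforce
qed

lemma colength_nonneg:
  assumes "number_partition d \<theta>"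
  shows "0 \<le> colength \<theta>"
  using cycle_class_nonempty[OF assms] sign_eq_colength by (auto simp: cycle_class_def)

lemma colength_pos:
  assumes "number_partition d \<theta>" "\<theta> \<noteq> replicate_mset d 1"
  shows "0 < colength \<theta>"
proof -
  have "size \<theta> \<le> sum_mset \<theta> \<and> (size \<theta> = sum_mset \<theta> \<longrightarrow> \<theta> = replicate_mset (sum_mset \<theta>) 1)"
    if "\<forall>i\<in>#\<theta>. 0 < i"
    using that
  proof (induction \<theta>)
    case (add i \<theta>)
    then show ?case by (cases "i = 1") auto
  qed simp
  then show ?thesis using assms by (auto simp: colength_def number_partition_def)
qed

lemma prod_list_sign_colength:
  assumes "\<forall>\<theta>\<in>set \<mu>. number_partition d \<theta>"
  shows "(\<Prod>\<theta>\<leftarrow>\<mu>. (-1) ^ nat (colength \<theta>)) = (-1 :: int) ^ nat (\<Sum>\<theta>\<leftarrow>\<mu>. colength \<theta>)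
    \<and> 0 \<le> (\<Sum>\<theta>\<leftarrow>\<mu>. colength \<theta>)"
  using assms
proof (induction \<mu>)
  case (Cons \<theta> \<mu>)
  then show ?case using colength_nonneg[of d \<theta>] by (simp add: nat_add_distrib power_add)
qed simp

lemma real_card_base_tuples:
  assumes "\<forall>\<theta>\<in>set \<mu>. number_partition d \<theta>"
  shows "real (card (base_tuples h d \<mu>))
    = fact d ^ (length \<mu> + 2 * h) / (\<Prod>\<theta>\<leftarrow>\<mu>. real (z_partition \<theta>))"
proof -
  have "real (\<Prod>\<theta>\<leftarrow>\<mu>. card (cycle_class d \<theta>)) = fact d ^ length \<mu> / (\<Prod>\<theta>\<leftarrow>\<mu>. real (z_partition \<theta>))"
    using assms by (induction \<mu>) (simp_all add: card_cycle_class)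
  then show ?thesis
    by (simp add: card_base_tuples power_add mult_2)
qed

lemma prod_list_z_partition_pos:
  assumes "\<forall>\<theta>\<in>set \<mu>. number_partition d \<theta>"
  shows "0 < (\<Prod>\<theta>\<leftarrow>\<mu>. real (z_partition \<theta>))"
  using assms by (induction \<mu>) (auto intro!: mult_pos_pos z_partition_pos)

theorem corollary1p3:
  fixes h d s :: nat
    and \<mu> :: "nat multiset list"
    and \<nu> :: "nat multiset"
    and q :: "nat \<Rightarrow> real"
  assumes "d \<ge> 5"
    and "length \<mu> = s"
    and "\<forall>\<theta>\<in>set \<mu>. number_partition d \<theta>"
    and "number_partition d \<nu>"
    and "\<nu> \<noteq> replicate_mset d 1"
    and "\<And>g. q g = 1 / real_of_int (colength \<nu>) *
           (2 * real g + (2 - 2 * real h) * real d - 2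
             - (\<Sum>\<theta>\<leftarrow>\<mu>. real_of_int (colength \<theta>)))"
  shows "(\<lambda>g. hurwitz_number h g d (\<mu> @ replicate (nat \<lfloor>q g\<rfloor>) \<nu>))
    \<sim>[inf at_top (principal {g. \<exists>k::nat. 0 < k \<and> q g = real k})]
    (\<lambda>g. 2 * fact d powi (int s + 2 * int h - 2)
           / (\<Prod>\<theta>\<leftarrow>\<mu>. real (z_partition \<theta>))
           * (fact d / real (z_partition \<nu>)) ^ nat \<lfloor>q g\<rfloor>)"
proof -
  let ?F = "inf at_top (principal {g. \<exists>k::nat. 0 < k \<and> q g = real k})"
  let ?n = "\<lambda>g. nat \<lfloor>q g\<rfloor>"
  let ?c = "real (card (cycle_class d \<nu>))"
  let ?\<Sigma> = "\<Sum>\<theta>\<leftarrow>\<mu>. colength \<theta>"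
  let ?L = "2 * fact d powi (int s + 2 * int h - 2) / (\<Prod>\<theta>\<leftarrow>\<mu>. real (z_partition \<theta>))"
  let ?P = "{n. (\<Prod>\<theta>\<leftarrow>\<mu>. (-1) ^ nat (colength \<theta>)) = (((-1) ^ nat (colength \<nu>)) ^ n :: int)}"
  define m where "m = (\<lambda>n. card (monodromy_tuples h d (\<mu> @ replicate n \<nu>)) / ?c ^ n / fact d)"
  have c_eq: "?c = fact d / real (z_partition \<nu>)" by (rule card_cycle_class[OF assms(4)])
  have c_pos: "0 < ?c" using card_cycle_class_pos[OF assms(4)] by simp
  have col: "0 < colength \<nu>" by (rule colength_pos[OF assms(4,5)])
  have z_pos: "0 < (\<Prod>\<theta>\<leftarrow>\<mu>. real (z_partition \<theta>))" by (rule prod_list_z_partition_pos[OF assms(3)])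
  have sum_eq: "(\<Sum>\<theta>\<leftarrow>\<mu>. real_of_int (colength \<theta>)) = real_of_int ?\<Sigma>"
    by (induction \<mu>) simp_all

  \<comment> \<open>The definition of \<open>q\<close> is the Riemann-Hurwitz relation solved for the number of copies of \<open>\<nu>\<close>.\<close>
  have riemann_hurwitz: "2 * int g - 2 = int d * (2 * int h - 2) + (?\<Sigma> + int k * colength \<nu>)"
    if "q g = real k" for g k
  proof -
    have "real k * real_of_int (colength \<nu>)
        = 2 * real g + (2 - 2 * real h) * real d - 2 - real_of_int ?\<Sigma>"
      using that assms(6)[of g] col sum_eq by (simp add: field_simps)
    then have "real_of_int (2 * int g - 2) = real_of_int (int d * (2 * int h - 2) + (?\<Sigma> + int k * colength \<nu>))"
      by (simp add: algebra_simps)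
    then show ?thesis by (simp only: of_int_eq_iff)
  qed

  \<comment> \<open>Both \<open>2 g - 2\<close> and \<open>d (2 h - 2)\<close> are even, hence so is the total colength.\<close>
  have parity: "k \<in> ?P" if "q g = real k" for g k
  proof -
    have "?\<Sigma> + int k * colength \<nu> = 2 * (int g - 1 - int d * (int h - 1))"
      using riemann_hurwitz[OF that] by (simp add: algebra_simps)
    then have "even (?\<Sigma> + int k * colength \<nu>)" by simp
    moreover have \<Sigma>: "(\<Prod>\<theta>\<leftarrow>\<mu>. (-1) ^ nat (colength \<theta>)) = (-1 :: int) ^ nat ?\<Sigma>" "0 \<le> ?\<Sigma>"
      using prod_list_sign_colength[OF assms(3)] by auto
    moreover have "even (int k * colength \<nu>) \<longleftrightarrow> even (nat (colength \<nu>) * k)"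
      using col by (auto simp: even_nat_iff)
    ultimately have "even (nat ?\<Sigma>) \<longleftrightarrow> even (nat (colength \<nu>) * k)" by (simp add: even_nat_iff)
    then show ?thesis
      unfolding mem_Collect_eq \<Sigma>(1) power_mult[symmetric] by (simp only: minus_one_power_iff)
  qed

  have "filterlim ?n sequentially at_top"
    unfolding filterlim_at_top eventually_sequentially
  proof (rule allI)
    fix N
    let ?b = "(2 - 2 * real h) * real d - 2 - real_of_int ?\<Sigma>"
    obtain G :: nat where G: "real_of_int (colength \<nu>) * real N - ?b \<le> real G"
      using real_arch_simple by blast
    have "N \<le> ?n g" if "g \<ge> G" for g
    proof -
      have "real_of_int (colength \<nu>) * real N \<le> 2 * real g + ?b" using G that by linarith
      then have "real N \<le> q g" using col by (simp add: assms(6) sum_eq field_simps)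
      then show ?thesis by (simp add: le_nat_iff le_floor_iff)
    qed
    then show "\<exists>G. \<forall>g\<ge>G. N \<le> ?n g" by blast
  qed
  then have "filterlim ?n sequentially ?F" by (rule filterlim_mono) simp_all
  moreover have "filterlim ?n (principal ?P) ?F"
    unfolding filterlim_principal eventually_inf_principal using parity by (intro always_eventually) auto
  ultimately have n_lim: "filterlim ?n (inf sequentially (principal ?P)) ?F" by (simp only: filterlim_inf)

  have "card (base_tuples h d \<mu>) * (2 / fact d) / fact d = ?L"
  proof -
    have "(fact d :: real) powi (int s + 2 * int h - 2) = fact d powi int (s + 2 * h) / fact d powi 2"
      by (subst power_int_diff) simp_all
    then show ?thesis
      by (simp add: real_card_base_tuples[OF assms(3)] assms(2) power2_eq_square power_int_of_nat mult_ac flip: of_nat_add)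
  qed
  then have "(m \<longlongrightarrow> ?L) (inf sequentially (principal ?P))"
    unfolding m_def
    using tendsto_divide[OF monodromy_density_tendsto[OF assms(1,4,5), of h \<mu>] tendsto_const[of "fact d"]] by simp
  then have "((\<lambda>g. m (?n g)) \<longlongrightarrow> ?L) ?F" using n_lim by (rule filterlim_compose)
  then have "((\<lambda>g. m (?n g) / ?L) \<longlongrightarrow> ?L / ?L) ?F" by (rule tendsto_divide) (use z_pos in simp_all)
  then have lim: "((\<lambda>g. m (?n g) / ?L) \<longlongrightarrow> 1) ?F" using z_pos by simp

  show ?thesis
  proof (rule asymp_equivI')
    have "hurwitz_number h g d (\<mu> @ replicate (?n g) \<nu>) / (?L * (fact d / real (z_partition \<nu>)) ^ ?n g) = m (?n g) / ?L"
      if k: "q g = real k" for g k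
    proof -
      have n: "?n g = k" using k by simp
      have "(\<Sum>\<theta>\<leftarrow>\<mu> @ replicate k \<nu>. colength \<theta>) = ?\<Sigma> + int k * colength \<nu>"
        by (simp add: sum_list_replicate)
      then have "hurwitz_number h g d (\<mu> @ replicate k \<nu>) = card (monodromy_tuples h d (\<mu> @ replicate k \<nu>)) / fact d"
        using riemann_hurwitz[OF k] by (simp only: hurwitz_number_def simp_thms if_True)
      then show ?thesis unfolding n c_eq[symmetric] m_def by (simp only: divide_divide_eq_left mult_ac)
    qed
    then have "\<forall>\<^sub>F g in ?F. m (?n g) / ?L
        = hurwitz_number h g d (\<mu> @ replicate (?n g) \<nu>) / (?L * (fact d / real (z_partition \<nu>)) ^ ?n g)"
      unfolding eventually_inf_principal by (intro always_eventually) auto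
    then show "((\<lambda>g. hurwitz_number h g d (\<mu> @ replicate (?n g) \<nu>)
        / (?L * (fact d / real (z_partition \<nu>)) ^ ?n g)) \<longlongrightarrow> 1) ?F"
      using lim by (rule Lim_transform_eventually[rotated])
  qed
qed

end
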